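(* Assume that $\mathbf{K}$ has a monster model, is $\operatorname{LS}(\mathbf{K})$-tame, and is stable in some cardinal greater than or equal to $\operatorname{LS}(\mathbf{K})$. Let $\chi_0 \ge \operatorname{LS}(\mathbf{K})$ be such that $\mathbf{K}$ does not have the $\operatorname{LS}(\mathbf{K})$-order property of length $\chi_0$, and let $\chi_2 := \beth_\omega(\chi_0)$. Let $\lambda \ge \chi_2$ be such that $\mathbf{K}$ is stable in $\lambda$ and there exists a saturated model of cardinality $\lambda$. If every limit model of cardinality $\lambda$ is $\chi_2$-saturated, then $\mathbf{K}$ has no long splitting chains in $\lambda$.
   Context: $\mathbf{K}$ is an abstract elementary class (AEC) with Löwenheim–Skolem number $\operatorname{LS}(\mathbf{K})$ and strong substructure relation $\le_{\mathbf{K}}$; $\mathbf{K}_\lambda$ is the class of its models of cardinality $\lambda$. Monster model: amalgamation, joint embedding, arbitrarily large models; one works inside it, $\mathrm{gS}(M)$ is the set of Galois types of length one over $M$, $\mathrm{gtp}(\bar a/A)$ the Galois type. $\mathbf{K}$ is $\chi$-tame if for every $M$ with $\|M\|\ge\chi$ and $p\ne q$ in $\mathrm{gS}(M)$ there is $M_0\le_{\mathbf{K}}M$ of size $\chi$ with $p\restriction M_0\ne q\restriction M_0$. Stable in $\lambda$: $|\mathrm{gS}(M)|\le\lambda$ for all $M\in\mathbf{K}_\lambda$. Order property: $\mathbf{K}$ has the $\alpha$-order property of length $\theta$ if there is $\langle \bar a_i : i<\theta\rangle$ with each $\bar a_i$ of length $\alpha$ such that for all $i_0<j_0<\theta$,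 $i_1<j_1<\theta$, $\mathrm{gtp}(\bar a_{i_0}\bar a_{j_0}/\emptyset)\ne\mathrm{gtp}(\bar a_{j_1}\bar a_{i_1}/\emptyset)$. $M$ is $\mu$-saturated ($\mu>\operatorname{LS}(\mathbf{K})$) if every Galois type over any $N\le_{\mathbf{K}}M$ with $\|N\|<\mu$ is realized in $M$; saturated means $\|M\|$-saturated. Splitting: $p\in\mathrm{gS}(M)$ $\lambda$-splits over $M_0\le_{\mathbf{K}}M$ if there are $N_1,N_2\in\mathbf{K}_\lambda$ with $M_0\le_{\mathbf{K}}N_\ell\le_{\mathbf{K}}M$ and $f:N_1\cong N_2$ fixing $M_0$ with $f(p\restriction N_1)\ne p\restriction N_2$. For $M,N\in\mathbf{K}_\lambda$, $N$ is universal over $M$ if $M\le_{\mathbf{K}}N$ and every $M'\in\mathbf{K}_\lambda$ with $M\le_{\mathbf{K}}M'$ embeds into $N$ over $M$. No long splitting chains in $\lambda$: for every limit $\delta<\lambda^+$, every increasing $\langle M_i:i<\delta\rangle$ in $\mathbf{K}_\lambda$ with $M_{i+1}$ universal over $M_i$, and every $p\in\mathrm{gS}(\bigcup_i M_i)$, some $i<\delta$ has $p$ not $\lambda$-splitting over $M_i$. Limit model of cardinality $\lambda$: the union $M_\delta$ of an increasing continuous chain $\langle M_i:i\le\delta\rangle$ in $\mathbf{K}_\lambda$, $\delta<\lambda^+$ limit, with $M_{i+1}$ universal over $M_i$. *)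

theory Defs
  imports Main
begin

unbundle cardinal_syntax

text \<open>
  Universe of discourse.  HOL has no proper classes.  The elements of all models are taken from one
  type 'a whose cardinality is a strong limit, and "set" means subset of 'a of
  cardinality strictly below that of 'a.  A class of structures is a HOL set of structures with
  small universes; since 'a always has room outside a small set, every extension of a small
  model by fewer than |UNIV| points is represented up to isomorphism.  No regularity is
  required: for any class in ZFC and any cardinal there is a strong limit cardinal above it, at
  which the class can be cut off.

  Cardinals and ordinals are well-orders in the sense of the cardinal library
  (Card_order is an initial ordinal), compared by \<open>\<le>o\<close>, \<open><o\<close>, \<open>=o\<close>.
\<close>

definition strong_limit :: "'a rel \<Rightarrow> bool" where
  "strong_limit r \<longleftrightarrow> Card_order r \<and> natLeq \<le>o r \<and>
     (\<forall>A. A \<subseteq> Field r \<and> |A| <o r \<longrightarrow> |Pow A| <o r)"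

definition small :: "'a set \<Rightarrow> bool" where
  "small A \<longleftrightarrow> |A| <o |UNIV :: 'a set|"

text \<open>
  \<open>d = \<beth>\<^sub>\<omega>(c)\<close>, the supremum of the cardinals \<open>\<beth>\<^sub>n(c)\<close>, here \<open>b n\<close>.  It is a
  predicate since a cardinal is only determined up to \<open>=o\<close>.
\<close>

definition is_beth_omega :: "'a rel \<Rightarrow> 'a rel \<Rightarrow> bool" where
  "is_beth_omega c d \<longleftrightarrow> Card_order d \<and>
     (\<exists>b :: nat \<Rightarrow> 'a rel.
        (\<forall>n. Card_order (b n)) \<and> b 0 =o c \<and> (\<forall>n. b (Suc n) =o ctwo ^c b n) \<and>
        (\<forall>n. b n \<le>o d) \<and>
        (\<forall>e :: 'a rel. Card_order e \<and> (\<forall>n. b n \<le>o e) \<longrightarrow> d \<le>o e))"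

definition limit_order :: "'i rel \<Rightarrow> bool" where
  "limit_order r \<longleftrightarrow> Well_order r \<and> Field r \<noteq> {} \<and> (\<forall>i\<in>Field r. \<exists>j. (i, j) \<in> r \<and> i \<noteq> j)"

definition is_succ :: "'i rel \<Rightarrow> 'i \<Rightarrow> 'i \<Rightarrow> bool" where
  "is_succ r i j \<longleftrightarrow> i \<in> underS r j \<and> (\<forall>k\<in>underS r j. (k, i) \<in> r)"

definition is_limit_elem :: "'i rel \<Rightarrow> 'i \<Rightarrow> bool" where
  "is_limit_elem r j \<longleftrightarrow> j \<in> Field r \<and> underS r j \<noteq> {} \<and> (\<nexists>i. is_succ r i j)"


section \<open>Structures in a finitary vocabulary\<close>

record ('f, 'r) vocabulary =
  funs :: "'f set"
  rels :: "'r set"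
  fun_arity :: "'f \<Rightarrow> nat"
  rel_arity :: "'r \<Rightarrow> nat"

record ('f, 'r, 'a) struct =
  univ :: "'a set"
  fn :: "'f \<Rightarrow> 'a list \<Rightarrow> 'a"
  rl :: "'r \<Rightarrow> 'a list \<Rightarrow> bool"

text \<open>
  The interpretations are normalised off their domains (\<open>undefined\<close>, resp. \<open>False\<close>), so that
  structures are equal as HOL values iff they are equal as structures.
\<close>

definition is_structure :: "('f, 'r) vocabulary \<Rightarrow> ('f, 'r, 'a) struct \<Rightarrow> bool" where
  "is_structure \<tau> M \<longleftrightarrow> univ M \<noteq> {} \<and>
     (\<forall>F xs. if F \<in> funs \<tau> \<and> length xs = fun_arity \<tau> F \<and> set xs \<subseteq> univ M
             then fn M F xs \<in> univ M else fn M F xs = undefined) \<and>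
     (\<forall>R xs. rl M R xs \<longrightarrow> R \<in> rels \<tau> \<and> length xs = rel_arity \<tau> R \<and> set xs \<subseteq> univ M)"

definition substructure ::
  "('f, 'r) vocabulary \<Rightarrow> ('f, 'r, 'a) struct \<Rightarrow> ('f, 'r, 'a) struct \<Rightarrow> bool" where
  "substructure \<tau> M N \<longleftrightarrow> is_structure \<tau> M \<and> is_structure \<tau> N \<and> univ M \<subseteq> univ N \<and>
     (\<forall>F\<in>funs \<tau>. \<forall>xs. set xs \<subseteq> univ M \<longrightarrow> length xs = fun_arity \<tau> F \<longrightarrow> fn M F xs = fn N F xs) \<and>
     (\<forall>R\<in>rels \<tau>. \<forall>xs. set xs \<subseteq> univ M \<longrightarrow> length xs = rel_arity \<tau> R \<longrightarrow> rl M R xs = rl N R xs)"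

definition iso ::
  "('f, 'r) vocabulary \<Rightarrow> ('a \<Rightarrow> 'a) \<Rightarrow> ('f, 'r, 'a) struct \<Rightarrow> ('f, 'r, 'a) struct \<Rightarrow> bool" where
  "iso \<tau> f M N \<longleftrightarrow> is_structure \<tau> M \<and> is_structure \<tau> N \<and> bij_betw f (univ M) (univ N) \<and>
     (\<forall>F\<in>funs \<tau>. \<forall>xs. set xs \<subseteq> univ M \<longrightarrow> length xs = fun_arity \<tau> F \<longrightarrow>
        f (fn M F xs) = fn N F (map f xs)) \<and>
     (\<forall>R\<in>rels \<tau>. \<forall>xs. set xs \<subseteq> univ M \<longrightarrow> length xs = rel_arity \<tau> R \<longrightarrow>
        rl M R xs = rl N R (map f xs))"

text \<open>Only meaningful for sets of structures directed under substructure, where the choice of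
  \<open>M\<close> is immaterial.\<close>

definition union_struct :: "('f, 'r, 'a) struct set \<Rightarrow> ('f, 'r, 'a) struct" where
  "union_struct S =
     \<lparr> univ = (\<Union>M\<in>S. univ M),
       fn = (\<lambda>F xs. if \<exists>M\<in>S. set xs \<subseteq> univ M
                    then fn (SOME M. M \<in> S \<and> set xs \<subseteq> univ M) F xs else undefined),
       rl = (\<lambda>R xs. \<exists>M\<in>S. rl M R xs) \<rparr>"


section \<open>Abstract elementary classes\<close>

record ('f, 'r, 'a) abstract_class =
  voc :: "('f, 'r) vocabulary"
  models :: "('f, 'r, 'a) struct set"
  leK :: "('f, 'r, 'a) struct \<Rightarrow> ('f, 'r, 'a) struct \<Rightarrow> bool"

definition LS_property :: "('f, 'r, 'a) abstract_class \<Rightarrow> 'a rel \<Rightarrow> bool" where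
  "LS_property K \<mu> \<longleftrightarrow> Card_order \<mu> \<and> natLeq \<le>o \<mu> \<and> |funs (voc K) <+> rels (voc K)| \<le>o \<mu> \<and>
     (\<forall>M\<in>models K. \<forall>A\<subseteq>univ M.
        \<exists>M0. leK K M0 M \<and> A \<subseteq> univ M0 \<and> |univ M0| \<le>o |A| +c \<mu>)"

text \<open>\<open>\<mu> = LS(K)\<close>\<close>

definition is_LS :: "('f, 'r, 'a) abstract_class \<Rightarrow> 'a rel \<Rightarrow> bool" where
  "is_LS K \<mu> \<longleftrightarrow> LS_property K \<mu> \<and> (\<forall>\<nu>. LS_property K \<nu> \<longrightarrow> \<mu> \<le>o \<nu>)"

definition increasing_chain ::
  "('f, 'r, 'a) abstract_class \<Rightarrow> 'a rel \<Rightarrow> ('a \<Rightarrow> ('f, 'r, 'a) struct) \<Rightarrow> bool" where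
  "increasing_chain K r M \<longleftrightarrow>
     (\<forall>i\<in>Field r. M i \<in> models K) \<and> (\<forall>i j. (i, j) \<in> r \<longrightarrow> leK K (M i) (M j))"

text \<open>
  In the chain axioms the union has to be a set in the above sense; this is automatic
  for chains of small length when the cardinality of 'a is regular.
\<close>

definition AEC :: "('f, 'r, 'a) abstract_class \<Rightarrow> bool" where
  "AEC K \<longleftrightarrow>
     (\<forall>M\<in>models K. is_structure (voc K) M \<and> small (univ M)) \<and>
     (\<forall>M N. leK K M N \<longrightarrow> M \<in> models K \<and> N \<in> models K \<and> substructure (voc K) M N) \<and>
     (\<forall>M\<in>models K. leK K M M) \<and>
     (\<forall>M N P. leK K M N \<and> leK K N P \<longrightarrow> leK K M P) \<and>
     \<comment> \<open>closure under isomorphism\<close>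
     (\<forall>M N f. M \<in> models K \<and> iso (voc K) f M N \<longrightarrow> N \<in> models K) \<and>
     (\<forall>M N M' N' f. leK K M N \<and> iso (voc K) f N N' \<and> iso (voc K) f M M' \<longrightarrow> leK K M' N') \<and>
     \<comment> \<open>coherence\<close>
     (\<forall>M0 M1 M2. leK K M0 M2 \<and> leK K M1 M2 \<and> substructure (voc K) M0 M1 \<longrightarrow> leK K M0 M1) \<and>
     \<comment> \<open>Tarski-Vaught chain axioms\<close>
     (\<forall>(r :: 'a rel) M. limit_order r \<and> increasing_chain K r M \<and> small (\<Union>i\<in>Field r. univ (M i)) \<longrightarrow>
        union_struct (M ` Field r) \<in> models K \<and>
        (\<forall>i\<in>Field r. leK K (M i) (union_struct (M ` Field r))) \<and>
        (\<forall>N. (\<forall>i\<in>Field r. leK K (M i) N) \<longrightarrow> leK K (union_struct (M ` Field r)) N)) \<and>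
     \<comment> \<open>Loewenheim-Skolem-Tarski axiom\<close>
     (\<exists>\<mu> :: 'a rel. LS_property K \<mu> \<and> \<mu> <o |UNIV :: 'a set| )"

definition models_of_card ::
  "('f, 'r, 'a) abstract_class \<Rightarrow> 'a rel \<Rightarrow> ('f, 'r, 'a) struct set" where
  "models_of_card K \<mu> = {M \<in> models K. |univ M| =o \<mu>}"

definition embedding ::
  "('f, 'r, 'a) abstract_class \<Rightarrow> ('a \<Rightarrow> 'a) \<Rightarrow> ('f, 'r, 'a) struct \<Rightarrow> ('f, 'r, 'a) struct \<Rightarrow> bool"
  where
  "embedding K f M N \<longleftrightarrow> M \<in> models K \<and> (\<exists>M'. iso (voc K) f M M' \<and> leK K M' N)"

abbreviation fixes_pointwise :: "('a \<Rightarrow> 'a) \<Rightarrow> 'a set \<Rightarrow> bool" where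
  "fixes_pointwise f A \<equiv> \<forall>x\<in>A. f x = x"

definition amalgamation :: "('f, 'r, 'a) abstract_class \<Rightarrow> bool" where
  "amalgamation K \<longleftrightarrow> (\<forall>M0 M1 M2. leK K M0 M1 \<and> leK K M0 M2 \<longrightarrow>
     (\<exists>N f1 f2. embedding K f1 M1 N \<and> embedding K f2 M2 N \<and>
        fixes_pointwise f1 (univ M0) \<and> fixes_pointwise f2 (univ M0)))"

definition joint_embedding :: "('f, 'r, 'a) abstract_class \<Rightarrow> bool" where
  "joint_embedding K \<longleftrightarrow> (\<forall>M1\<in>models K. \<forall>M2\<in>models K.
     \<exists>N f1 f2. embedding K f1 M1 N \<and> embedding K f2 M2 N)"

definition arbitrarily_large_models :: "('f, 'r, 'a) abstract_class \<Rightarrow> bool" where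
  "arbitrarily_large_models K \<longleftrightarrow>
     (\<forall>A :: 'a set. small A \<longrightarrow> (\<exists>M\<in>models K. |A| \<le>o |univ M| ))"

definition has_monster_model :: "('f, 'r, 'a) abstract_class \<Rightarrow> bool" where
  "has_monster_model K \<longleftrightarrow> amalgamation K \<and> joint_embedding K \<and> arbitrarily_large_models K"


section \<open>Galois types\<close>

text \<open>
  Instead of orbits in a monster model, Galois types are the classes of triples
  \<open>(b, A, N)\<close>, with \<open>A\<close> a subset of \<open>N\<close> and \<open>b\<close> a tuple from \<open>N\<close> indexed by \<open>I\<close>, under the
  transitive closure of "\<open>N1\<close> and \<open>N2\<close> embed over \<open>A\<close> into a common model, identifying the tuples";
  under amalgamation this is the same notion.  A type over \<open>A\<close> is a set of pairs \<open>(b, N)\<close>.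
\<close>

definition gtp_atomic ::
  "('f, 'r, 'a) abstract_class \<Rightarrow> 'i set \<Rightarrow> 'a set \<Rightarrow> (('i \<Rightarrow> 'a) \<times> ('f, 'r, 'a) struct) rel" where
  "gtp_atomic K I A = {((b1, N1), (b2, N2)).
     A \<subseteq> univ N1 \<and> A \<subseteq> univ N2 \<and> b1 ` I \<subseteq> univ N1 \<and> b2 ` I \<subseteq> univ N2 \<and>
     (\<exists>N f1 f2. embedding K f1 N1 N \<and> embedding K f2 N2 N \<and>
        fixes_pointwise f1 A \<and> fixes_pointwise f2 A \<and> (\<forall>i\<in>I. f1 (b1 i) = f2 (b2 i)))}"

type_synonym ('f, 'r, 'a, 'i) gtype = "(('i \<Rightarrow> 'a) \<times> ('f, 'r, 'a) struct) set"

definition gtp ::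
  "('f, 'r, 'a) abstract_class \<Rightarrow> 'i set \<Rightarrow> ('i \<Rightarrow> 'a) \<Rightarrow> 'a set \<Rightarrow> ('f, 'r, 'a) struct
     \<Rightarrow> ('f, 'r, 'a, 'i) gtype" where
  "gtp K I b A N = (gtp_atomic K I A)\<^sup>+ `` {(b, N)}"

definition gtp1 ::
  "('f, 'r, 'a) abstract_class \<Rightarrow> 'a \<Rightarrow> 'a set \<Rightarrow> ('f, 'r, 'a) struct \<Rightarrow> ('f, 'r, 'a, unit) gtype"
  where
  "gtp1 K a A N = gtp K UNIV (\<lambda>_. a) A N"

definition gS ::
  "('f, 'r, 'a) abstract_class \<Rightarrow> ('f, 'r, 'a) struct \<Rightarrow> ('f, 'r, 'a, unit) gtype set" where
  "gS K M = {gtp1 K a (univ M) N | a N. leK K M N \<and> a \<in> univ N}"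

text \<open>The union is over equal sets: all representatives of a type give the same restriction.\<close>

definition restrict_type ::
  "('f, 'r, 'a) abstract_class \<Rightarrow> ('f, 'r, 'a, unit) gtype \<Rightarrow> ('f, 'r, 'a) struct
     \<Rightarrow> ('f, 'r, 'a, unit) gtype" where
  "restrict_type K p M0 = (\<Union>(b, N)\<in>p. gtp K UNIV b (univ M0) N)"

text \<open>
  \<open>f(p)\<close> for \<open>f\<close> an isomorphism with domain \<open>M\<close> and \<open>p \<in> gS(M)\<close>: extend \<open>f\<close> to an isomorphism
  \<open>g\<close> defined on a model that contains a realization of \<open>p\<close>.  Again a union over equal sets.
\<close>

definition image_type ::
  "('f, 'r, 'a) abstract_class \<Rightarrow> ('a \<Rightarrow> 'a) \<Rightarrow> ('f, 'r, 'a) struct \<Rightarrow> ('f, 'r, 'a, unit) gtype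
     \<Rightarrow> ('f, 'r, 'a, unit) gtype" where
  "image_type K f M p =
     \<Union>{gtp K UNIV (g \<circ> b) (f ` univ M) N' | g b N N'.
         (b, N) \<in> p \<and> iso (voc K) g N N' \<and> (\<forall>x\<in>univ M. g x = f x)}"

definition tame :: "('f, 'r, 'a) abstract_class \<Rightarrow> 'a rel \<Rightarrow> bool" where
  "tame K \<chi> \<longleftrightarrow> (\<forall>M\<in>models K. \<chi> \<le>o |univ M| \<longrightarrow> (\<forall>p\<in>gS K M. \<forall>q\<in>gS K M. p \<noteq> q \<longrightarrow>
     (\<exists>M0\<in>models_of_card K \<chi>. leK K M0 M \<and> restrict_type K p M0 \<noteq> restrict_type K q M0)))"

definition stable_in :: "('f, 'r, 'a) abstract_class \<Rightarrow> 'a rel \<Rightarrow> bool" where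
  "stable_in K \<mu> \<longleftrightarrow> (\<forall>M\<in>models_of_card K \<mu>. |gS K M| \<le>o \<mu>)"

text \<open>
  The sequence lies in the monster model, i.e. in some common model \<open>N\<close>.  A tuple of length
  \<open>\<alpha>\<close> is a function on \<open>Field \<alpha>\<close>, and the concatenation of two tuples is
  indexed by the disjoint sum.
\<close>

definition order_property :: "('f, 'r, 'a) abstract_class \<Rightarrow> 'i rel \<Rightarrow> 'j rel \<Rightarrow> bool" where
  "order_property K \<alpha> \<theta> \<longleftrightarrow>
     (\<exists>N\<in>models K. \<exists>a :: 'j \<Rightarrow> 'i \<Rightarrow> 'a.
        (\<forall>i\<in>Field \<theta>. a i ` Field \<alpha> \<subseteq> univ N) \<and>
        (\<forall>i0 j0 i1 j1. (i0, j0) \<in> \<theta> - Id \<and> (i1, j1) \<in> \<theta> - Id \<longrightarrow>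
           gtp K (Field \<alpha> <+> Field \<alpha>) (case_sum (a i0) (a j0)) {} N \<noteq>
           gtp K (Field \<alpha> <+> Field \<alpha>) (case_sum (a j1) (a i1)) {} N))"

definition saturated_in ::
  "('f, 'r, 'a) abstract_class \<Rightarrow> 'a rel \<Rightarrow> ('f, 'r, 'a) struct \<Rightarrow> bool" where
  "saturated_in K \<mu> M \<longleftrightarrow> M \<in> models K \<and>
     (\<forall>N. leK K N M \<and> |univ N| <o \<mu> \<longrightarrow> (\<forall>p\<in>gS K N. \<exists>a\<in>univ M. p = gtp1 K a (univ N) M))"

definition saturated :: "('f, 'r, 'a) abstract_class \<Rightarrow> ('f, 'r, 'a) struct \<Rightarrow> bool" where
  "saturated K M \<longleftrightarrow> saturated_in K |univ M| M"


section \<open>Splitting and limit models\<close>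

definition splits ::
  "('f, 'r, 'a) abstract_class \<Rightarrow> 'a rel \<Rightarrow> ('f, 'r, 'a) struct \<Rightarrow> ('f, 'r, 'a, unit) gtype
     \<Rightarrow> ('f, 'r, 'a) struct \<Rightarrow> bool" where
  "splits K \<mu> M p M0 \<longleftrightarrow> p \<in> gS K M \<and> leK K M0 M \<and>
     (\<exists>N1\<in>models_of_card K \<mu>. \<exists>N2\<in>models_of_card K \<mu>. \<exists>f.
        leK K M0 N1 \<and> leK K N1 M \<and> leK K M0 N2 \<and> leK K N2 M \<and>
        iso (voc K) f N1 N2 \<and> fixes_pointwise f (univ M0) \<and>
        image_type K f N1 (restrict_type K p N1) \<noteq> restrict_type K p N2)"

definition universal_over ::
  "('f, 'r, 'a) abstract_class \<Rightarrow> 'a rel \<Rightarrow> ('f, 'r, 'a) struct \<Rightarrow> ('f, 'r, 'a) struct \<Rightarrow> bool" where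
  "universal_over K \<mu> N M \<longleftrightarrow> M \<in> models_of_card K \<mu> \<and> N \<in> models_of_card K \<mu> \<and> leK K M N \<and>
     (\<forall>M'\<in>models_of_card K \<mu>. leK K M M' \<longrightarrow>
        (\<exists>f. embedding K f M' N \<and> fixes_pointwise f (univ M)))"

text \<open>
  A limit ordinal \<open>\<delta> < \<mu>\<^sup>+\<close> is a limit well-order \<open>r\<close> with \<open>|Field r| \<le>o \<mu>\<close>; its elements
  are the indices.
\<close>

definition universal_chain ::
  "('f, 'r, 'a) abstract_class \<Rightarrow> 'a rel \<Rightarrow> 'a rel \<Rightarrow> ('a \<Rightarrow> ('f, 'r, 'a) struct) \<Rightarrow> bool" where
  "universal_chain K \<mu> r M \<longleftrightarrow> limit_order r \<and> |Field r| \<le>o \<mu> \<and>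
     increasing_chain K r M \<and> (\<forall>i\<in>Field r. M i \<in> models_of_card K \<mu>) \<and>
     (\<forall>i j. is_succ r i j \<longrightarrow> universal_over K \<mu> (M j) (M i))"

definition no_long_splitting_chains :: "('f, 'r, 'a) abstract_class \<Rightarrow> 'a rel \<Rightarrow> bool" where
  "no_long_splitting_chains K \<mu> \<longleftrightarrow>
     (\<forall>r M. universal_chain K \<mu> r M \<longrightarrow>
        (\<forall>p\<in>gS K (union_struct (M ` Field r)).
           \<exists>i\<in>Field r. \<not> splits K \<mu> (union_struct (M ` Field r)) p (M i)))"

definition limit_model ::
  "('f, 'r, 'a) abstract_class \<Rightarrow> 'a rel \<Rightarrow> ('f, 'r, 'a) struct \<Rightarrow> bool" where
  "limit_model K \<mu> L \<longleftrightarrow>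
     (\<exists>r M. universal_chain K \<mu> r M \<and>
        (\<forall>j. is_limit_elem r j \<longrightarrow> M j = union_struct (M ` underS r j)) \<and>
        L = union_struct (M ` Field r))"

end

theory Submission
  imports Defs
begin

text \<open>
  Let \<open>p \<in> gS(L)\<close> be realized by \<open>a\<close>, where \<open>L\<close> is the union of a universal chain \<open>M\<^sub>i\<close>, and
  suppose that \<open>p\<close> splits over every \<open>M\<^sub>i\<close>.  By tameness there are tuples \<open>b\<^sub>i, b'\<^sub>i\<close> in \<open>L\<close> of length
  \<open>LS(K)\<close> with the same type over \<open>M\<^sub>i\<close> such that \<open>a b\<^sub>i\<close> and \<open>a b'\<^sub>i\<close> have different types.  Call \<open>i\<close> good
  for \<open>x\<close> if \<open>x b\<^sub>i\<close> and \<open>x b'\<^sub>i\<close> have the same type; every \<open>i\<close> with \<open>x \<in> M\<^sub>i\<close> is good for \<open>x\<close>.  Since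
  \<open>L\<close> is a limit model up to the values of the chain at limit indices, it is saturated enough: for
  every set \<open>C\<close> of at most \<open>\<chi>\<^sub>0\<close> indices, some \<open>x \<in> L\<close> has no good index in \<open>C\<close>.  If \<open>x \<in> M\<^sub>j\<close>, then
  \<open>C\<close> is bounded by \<open>j\<close>.  Hence one can choose recursively \<open>x\<^sub>k \<in> L\<close> and \<open>i\<^sub>k\<close> for \<open>k < \<chi>\<^sub>0\<close> such that no
  earlier \<open>i\<^sub>l\<close> is good for \<open>x\<^sub>k\<close>, while \<open>i\<^sub>k\<close> is good for all earlier \<open>x\<^sub>l\<close>.  The concatenations of \<open>x\<^sub>k\<close>,
  \<open>b\<close> and \<open>b'\<close> at \<open>i\<^sub>k\<close> witness the order property of length \<open>\<chi>\<^sub>0\<close>.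
\<close>

section \<open>Permutations of the universe\<close>

text \<open>A small set has a complement of full cardinality, so the complements of \<open>A\<close>
  and of its image are equinumerous, and a bijection between them completes \<open>f\<close>. Such
  permutations serve to rename whole models while keeping prescribed values on a small set.\<close>

lemma bij_extension:
  fixes f :: "'a \<Rightarrow> 'a"
  assumes inf: "infinite (UNIV :: 'a set)" and A: "small A" and f: "inj_on f A"
  obtains g where "bij g" "\<And>x. x \<in> A \<Longrightarrow> g x = f x"
proof -
  have compl: "|- B| =o |UNIV :: 'a set|" if "small B" for B :: "'a set"
  proof (rule ccontr)
    assume "\<not> ?thesis"
    then have "|- B| <o |UNIV :: 'a set|"
      using card_of_mono1[of "- B" UNIV] ordLeq_iff_ordLess_or_ordIso by auto
    then have "|B \<union> - B| <o |UNIV :: 'a set|"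
      using card_of_Un_ordLess_infinite[OF inf] that unfolding small_def by blast
    then show False using ordLess_irreflexive by (metis Compl_partition)
  qed
  have "small (f ` A)"
    using A card_of_image[of f A] ordLeq_ordLess_trans by (auto simp: small_def)
  then have "|- A| =o |- (f ` A)|"
    using compl A ordIso_symmetric ordIso_transitive by blast
  then obtain h where h: "bij_betw h (- A) (- (f ` A))"
    using card_of_ordIso by blast
  define g where "g = (\<lambda>x. if x \<in> A then f x else h x)"
  have 1: "bij_betw g A (f ` A)"
    using f by (simp add: g_def bij_betw_def inj_on_def)
  have "bij_betw g (- A) (- (f ` A)) = bij_betw h (- A) (- (f ` A))"
    by (rule bij_betw_cong) (simp add: g_def)
  then have 2: "bij_betw g (- A) (- (f ` A))" using h by blast
  have "bij_betw g (A \<union> - A) (f ` A \<union> - (f ` A))"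
    by (rule bij_betw_combine[OF 1 2]) auto
  then have "bij g" by (simp add: Compl_partition)
  then show thesis using that by (simp add: g_def)
qed


section \<open>Isomorphisms\<close>

lemma iso_id: "is_structure \<tau> M \<Longrightarrow> iso \<tau> id M M"
  by (simp add: iso_def)

lemma iso_structure: "iso \<tau> f M N \<Longrightarrow> is_structure \<tau> M \<and> is_structure \<tau> N"
  by (simp add: iso_def)

lemma iso_image: "iso \<tau> f M N \<Longrightarrow> f ` univ M = univ N"
  by (simp add: iso_def bij_betw_def)

lemma iso_inj_on: "iso \<tau> f M N \<Longrightarrow> inj_on f (univ M)"
  by (simp add: iso_def bij_betw_def)

lemma structure_closed:
  "is_structure \<tau> M \<Longrightarrow> F \<in> funs \<tau> \<Longrightarrow> length xs = fun_arity \<tau> F \<Longrightarrow> set xs \<subseteq> univ M \<Longrightarrow>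
    fn M F xs \<in> univ M"
  unfolding is_structure_def by meson

lemma iso_comp:
  assumes f: "iso \<tau> f M N" and g: "iso \<tau> g N P"
  shows "iso \<tau> (g \<circ> f) M P"
proof -
  have "set (map f xs) \<subseteq> univ N" if "set xs \<subseteq> univ M" for xs
    using that iso_image[OF f] by auto
  then show ?thesis
    using f g bij_betw_trans[of f "univ M" "univ N" g "univ P"]
    unfolding iso_def by (simp flip: map_map)
qed

text \<open>Structures are closed under their functions, so no clause of \<open>iso\<close> sees
  \<open>f\<close> outside \<open>univ M\<close>. A map can thus be exchanged for a permutation
  extending it.\<close>

lemma iso_cong:
  assumes f: "iso \<tau> f M N" and g: "\<And>x. x \<in> univ M \<Longrightarrow> g x = f x"
  shows "iso \<tau> g M N"
proof -
  have "map g xs = map f xs" if "set xs \<subseteq> univ M" for xs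
    using that g by (simp add: subset_iff)
  moreover have "bij_betw g (univ M) (univ N)"
    using f g bij_betw_cong[of "univ M" g f] by (simp add: iso_def)
  ultimately show ?thesis
    using f g structure_closed[of \<tau> M] unfolding iso_def by metis
qed

lemma iso_inv:
  assumes f: "iso \<tau> f M N"
  shows "iso \<tau> (inv_into (univ M) f) N M"
proof -
  let ?g = "inv_into (univ M) f"
  have *: "f (?g y) = y" "?g y \<in> univ M" if "y \<in> univ N" for y
    using that iso_image[OF f] by (metis f_inv_into_f) (metis iso_image[OF f] inv_into_into that)
  have xs: "map f (map ?g ys) = ys" "set (map ?g ys) \<subseteq> univ M" if "set ys \<subseteq> univ N" for ys
    using that * by (auto simp: subset_iff intro!: map_idI)
  have bij: "bij_betw ?g (univ N) (univ M)"
    using f bij_betw_inv_into by (auto simp: iso_def)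
  have "?g (fn N F ys) = fn M F (map ?g ys)"
    if "F \<in> funs \<tau>" "set ys \<subseteq> univ N" "length ys = fun_arity \<tau> F" for F ys
  proof -
    have "f (fn M F (map ?g ys)) = fn N F ys"
      using f that xs[OF that(2)] unfolding iso_def by (metis length_map)
    moreover have "fn M F (map ?g ys) \<in> univ M"
      using structure_closed[of \<tau> M F] iso_structure[OF f] xs[OF that(2)] that by simp
    ultimately show ?thesis
      using inv_into_f_f[OF iso_inj_on[OF f]] by metis
  qed
  moreover have "rl N R ys = rl M R (map ?g ys)"
    if "R \<in> rels \<tau>" "set ys \<subseteq> univ N" "length ys = rel_arity \<tau> R" for R ys
    using f that xs[OF that(2)] unfolding iso_def by (metis length_map)
  ultimately show ?thesis
    using bij f unfolding iso_def by blast
qed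

text \<open>The copy of \<open>M\<close> transported along a map injective on \<open>univ M\<close>.
  Functions are reset to \<open>undefined\<close> off their domain, as \<open>is_structure\<close>
  demands; relations inherit the arity test from \<open>M\<close>, because \<open>map h\<close>
  preserves lengths.\<close>

definition image_struct ::
  "('f, 'r) vocabulary \<Rightarrow> ('a \<Rightarrow> 'a) \<Rightarrow> ('f, 'r, 'a) struct \<Rightarrow> ('f, 'r, 'a) struct" where
  "image_struct \<tau> g M =
     (let h = inv_into (univ M) g in
      \<lparr> univ = g ` univ M,
        fn = (\<lambda>F xs. if F \<in> funs \<tau> \<and> length xs = fun_arity \<tau> F \<and> set xs \<subseteq> g ` univ M
                     then g (fn M F (map h xs)) else undefined),
        rl = (\<lambda>R xs. set xs \<subseteq> g ` univ M \<and> rl M R (map h xs)) \<rparr>)"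

lemma iso_image_struct:
  assumes M: "is_structure \<tau> M" and g: "inj_on g (univ M)"
  shows "iso \<tau> g M (image_struct \<tau> g M)"
proof -
  let ?h = "inv_into (univ M) g"
  have closed: "set (map ?h xs) \<subseteq> univ M" if "set xs \<subseteq> g ` univ M" for xs
    using that by (auto simp: subset_iff inv_into_into)
  have inv: "map (?h \<circ> g) xs = xs" if "set xs \<subseteq> univ M" for xs
    using that g by (auto simp: subset_iff intro!: map_idI)
  have sub: "set (map g xs) \<subseteq> g ` univ M" if "set xs \<subseteq> univ M" for xs
    using that by auto
  have ne: "univ M \<noteq> {}" using M by (simp add: is_structure_def)
  have rel: "R \<in> rels \<tau> \<and> length xs = rel_arity \<tau> R" if "rl M R xs" for R xs
    using M that by (simp add: is_structure_def)
  have "g (fn M F (map ?h xs)) \<in> g ` univ M"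
    if "F \<in> funs \<tau>" "length xs = fun_arity \<tau> F" "set xs \<subseteq> g ` univ M" for F xs
    using structure_closed[OF M that(1), of "map ?h xs"] closed that by simp
  then have "is_structure \<tau> (image_struct \<tau> g M)"
    using ne rel by (force simp: is_structure_def image_struct_def Let_def)
  then show ?thesis
    using M g inv sub unfolding iso_def
    by (auto simp: image_struct_def Let_def bij_betw_def)
qed

text \<open>The interpretations agree on the common universe by hypothesis, and off it by the
  normalisation in \<open>is_structure\<close>. This turns mutual \<open>leK\<close> into
  equality.\<close>

lemma substructure_antisym:
  fixes M N :: "('f, 'r, 'a) struct"
  assumes MN: "substructure \<tau> M N" and NM: "substructure \<tau> N M"
  shows "M = N"
proof (rule struct.equality)
  show u: "univ M = univ N" using assms by (auto simp: substructure_def)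
  show "fn M = fn N"
  proof (intro ext)
    fix F xs
    show "fn M F xs = fn N F xs"
    proof (cases "F \<in> funs \<tau> \<and> length xs = fun_arity \<tau> F \<and> set xs \<subseteq> univ M")
      case True
      then show ?thesis using MN by (simp add: substructure_def)
    next
      case False
      have "is_structure \<tau> M" "is_structure \<tau> N" using MN by (auto simp: substructure_def)
      then show ?thesis using False u unfolding is_structure_def by metis
    qed
  qed
  show "rl M = rl N"
  proof (intro ext)
    fix R xs
    have "is_structure \<tau> M" "is_structure \<tau> N" using MN by (auto simp: substructure_def)
    then show "rl M R xs = rl N R xs"
      using MN u unfolding is_structure_def substructure_def by metis
  qed
qed simp


section \<open>Embeddings and Galois types\<close>

text \<open>Infinity of the type enters through \<open>bij_extension\<close>, so that models can be
  renamed inside \<open>'a\<close>.\<close>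

locale aec =
  fixes K :: "('f, 'r, 'a) abstract_class"
  assumes aec: "AEC K" and infinite_UNIV: "infinite (UNIV :: 'a set)"
begin

section \<open>The axioms of an AEC as separate rules\<close>

lemma structure_models: "M \<in> models K \<Longrightarrow> is_structure (voc K) M"
  and small_models: "M \<in> models K \<Longrightarrow> small (univ M)"
  using aec[unfolded AEC_def, THEN conjunct1] by blast+

lemma leK_models1: "leK K M N \<Longrightarrow> M \<in> models K"
  and leK_models2: "leK K M N \<Longrightarrow> N \<in> models K"
  and leK_substructure: "leK K M N \<Longrightarrow> substructure (voc K) M N"
  using aec[unfolded AEC_def, THEN conjunct2, THEN conjunct1] by blast+

lemma leK_refl: "M \<in> models K \<Longrightarrow> leK K M M"
  using aec[unfolded AEC_def, THEN conjunct2, THEN conjunct2, THEN conjunct1] by blast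

lemma leK_trans: "leK K M N \<Longrightarrow> leK K N P \<Longrightarrow> leK K M P"
  using aec[unfolded AEC_def, THEN conjunct2, THEN conjunct2, THEN conjunct2, THEN conjunct1] by blast

lemma iso_models: "M \<in> models K \<Longrightarrow> iso (voc K) f M N \<Longrightarrow> N \<in> models K"
  using aec[unfolded AEC_def, THEN conjunct2, THEN conjunct2, THEN conjunct2, THEN conjunct2, THEN conjunct1] by blast

lemma leK_iso: "leK K M N \<Longrightarrow> iso (voc K) f N N' \<Longrightarrow> iso (voc K) f M M' \<Longrightarrow> leK K M' N'"
  using aec[unfolded AEC_def, THEN conjunct2, THEN conjunct2, THEN conjunct2, THEN conjunct2, THEN conjunct2, THEN conjunct1] by blast

lemma coherence: "leK K M0 M2 \<Longrightarrow> leK K M1 M2 \<Longrightarrow> substructure (voc K) M0 M1 \<Longrightarrow> leK K M0 M1"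
  using aec[unfolded AEC_def, THEN conjunct2, THEN conjunct2, THEN conjunct2, THEN conjunct2, THEN conjunct2, THEN conjunct2, THEN conjunct1] by blast

lemma union_struct_chain:
  fixes r :: "'a rel"
  assumes "limit_order r" "increasing_chain K r M" "small (\<Union>i\<in>Field r. univ (M i))"
  shows "union_struct (M ` Field r) \<in> models K"
    and "\<And>i. i \<in> Field r \<Longrightarrow> leK K (M i) (union_struct (M ` Field r))"
    and "\<And>N. (\<And>i. i \<in> Field r \<Longrightarrow> leK K (M i) N) \<Longrightarrow> leK K (union_struct (M ` Field r)) N"
proof -
  have *: "union_struct (M ` Field r) \<in> models K \<and>
      (\<forall>i\<in>Field r. leK K (M i) (union_struct (M ` Field r))) \<and>
      (\<forall>N. (\<forall>i\<in>Field r. leK K (M i) N) \<longrightarrow> leK K (union_struct (M ` Field r)) N)"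
    using aec[unfolded AEC_def, THEN conjunct2, THEN conjunct2, THEN conjunct2, THEN conjunct2, THEN conjunct2, THEN conjunct2, THEN conjunct2, THEN conjunct1] assms by blast
  then show "union_struct (M ` Field r) \<in> models K" by blast
  show "leK K (M i) (union_struct (M ` Field r))" if "i \<in> Field r" for i
    using * that by blast
  show "leK K (union_struct (M ` Field r)) N" if "\<And>i. i \<in> Field r \<Longrightarrow> leK K (M i) N" for N
    using * that by blast
qed

lemma leK_univ: "leK K M N \<Longrightarrow> univ M \<subseteq> univ N"
  using leK_substructure by (auto simp: substructure_def)

text \<open>Both structures inherit their interpretations from \<open>M2\<close>, so inclusion of
  universes already makes \<open>M0\<close> a substructure of \<open>M1\<close>.\<close>

lemma leK_coherence:
  assumes "leK K M0 M2" "leK K M1 M2" "univ M0 \<subseteq> univ M1"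
  shows "leK K M0 M1"
proof (rule coherence[OF assms(1,2)])
  have "substructure (voc K) M0 M2" "substructure (voc K) M1 M2"
    using assms leK_substructure by auto
  then show "substructure (voc K) M0 M1"
    using assms(3) unfolding substructure_def by (auto dest: subset_trans)
qed

lemma leK_image:
  assumes "leK K M N" "iso (voc K) g N N'"
  shows "leK K (image_struct (voc K) g M) N'" "iso (voc K) g M (image_struct (voc K) g M)"
proof -
  have "inj_on g (univ M)"
    using inj_on_subset iso_inj_on[OF assms(2)] leK_univ[OF assms(1)] by blast
  then show "iso (voc K) g M (image_struct (voc K) g M)"
    using iso_image_struct structure_models leK_models1[OF assms(1)] by blast
  then show "leK K (image_struct (voc K) g M) N'"
    using assms leK_iso by blast
qed

section \<open>Embeddings and their normalisation to inclusions\<close>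

lemma embedding_leK: "leK K M N \<Longrightarrow> embedding K id M N"
  unfolding embedding_def using iso_id leK_models1 structure_models by blast

lemma embedding_comp:
  assumes f: "embedding K f M N" and g: "embedding K g N P"
  shows "embedding K (g \<circ> f) M P"
proof -
  obtain M' N' where "iso (voc K) f M M'" "leK K M' N" "iso (voc K) g N N'" "leK K N' P"
    using f g by (auto simp: embedding_def)
  then show ?thesis
    using f leK_image[of M' N g N'] iso_comp leK_trans unfolding embedding_def by meson
qed

lemma embedding_iso:
  assumes "M \<in> models K" "iso (voc K) f M N"
  shows "embedding K f M N"
  using assms iso_models leK_refl unfolding embedding_def by blast

lemma embedding_image_subset: "embedding K f M N \<Longrightarrow> f ` univ M \<subseteq> univ N"
  unfolding embedding_def using iso_image leK_univ by metis

lemma embedding_models: "embedding K f M N \<Longrightarrow> M \<in> models K \<and> N \<in> models K"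
  unfolding embedding_def using leK_models2 by blast

text \<open>The inverse of \<open>f\<close> on its image extends to a permutation \<open>s\<close>;
  renaming \<open>N\<close> along \<open>s\<close> turns the embedding into an inclusion.\<close>

lemma embedding_rename:
  assumes f: "embedding K f M N"
  obtains s N' where "bij s" "iso (voc K) s N N'" "leK K M N'"
    "\<And>x. x \<in> univ M \<Longrightarrow> s (f x) = x"
proof -
  obtain M' where M': "iso (voc K) f M M'" "leK K M' N"
    using f by (auto simp: embedding_def)
  have "inj_on (inv_into (univ M) f) (univ M')"
    using iso_inv[OF M'(1)] iso_inj_on by blast
  then obtain s where s: "bij s" "\<And>x. x \<in> univ M' \<Longrightarrow> s x = inv_into (univ M) f x"
    using bij_extension[OF infinite_UNIV small_models[OF leK_models1[OF M'(2)]]] by metis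
  have N': "iso (voc K) s N (image_struct (voc K) s N)"
    using iso_image_struct structure_models leK_models2[OF M'(2)] s(1)
    by (metis bij_def inj_on_subset subset_UNIV)
  have "iso (voc K) s M' M"
    using iso_cong[OF iso_inv[OF M'(1)]] s(2) by blast
  then have "leK K M (image_struct (voc K) s N)"
    using leK_iso[OF M'(2) N'] by blast
  moreover have "s (f x) = x" if "x \<in> univ M" for x
    using that s(2) iso_image[OF M'(1)] iso_inj_on[OF M'(1)] by (metis image_eqI inv_into_f_f)
  ultimately show thesis using that s(1) N' by blast
qed

section \<open>Galois types as an equivalence of realizations\<close>

abbreviation same_type ::
  "'i set \<Rightarrow> 'a set \<Rightarrow> ('i \<Rightarrow> 'a) \<times> ('f, 'r, 'a) struct \<Rightarrow> ('i \<Rightarrow> 'a) \<times> ('f, 'r, 'a) struct \<Rightarrow> bool"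
  where "same_type I A x y \<equiv> (x, y) \<in> (gtp_atomic K I A)\<^sup>+"

lemma gtp_atomicI:
  assumes "A \<subseteq> univ N1" "A \<subseteq> univ N2" "b1 ` I \<subseteq> univ N1" "b2 ` I \<subseteq> univ N2"
    "embedding K f1 N1 N" "embedding K f2 N2 N" "fixes_pointwise f1 A" "fixes_pointwise f2 A"
    "\<And>i. i \<in> I \<Longrightarrow> f1 (b1 i) = f2 (b2 i)"
  shows "((b1, N1), (b2, N2)) \<in> gtp_atomic K I A"
proof -
  have "\<exists>N f1 f2. embedding K f1 N1 N \<and> embedding K f2 N2 N \<and> fixes_pointwise f1 A \<and>
      fixes_pointwise f2 A \<and> (\<forall>i\<in>I. f1 (b1 i) = f2 (b2 i))"
    by (rule exI[of _ N], rule exI[of _ f1], rule exI[of _ f2]) (use assms in simp)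
  then show ?thesis using assms(1-4) by (simp add: gtp_atomic_def)
qed

lemma gtp_atomicE:
  assumes "((b1, N1), (b2, N2)) \<in> gtp_atomic K I A"
  obtains f1 N f2 where
    "A \<subseteq> univ N1" "A \<subseteq> univ N2" "b1 ` I \<subseteq> univ N1" "b2 ` I \<subseteq> univ N2"
    "embedding K f1 N1 N" "embedding K f2 N2 N" "fixes_pointwise f1 A" "fixes_pointwise f2 A"
    "\<forall>i\<in>I. f1 (b1 i) = f2 (b2 i)"
proof -
  have *: "A \<subseteq> univ N1" "A \<subseteq> univ N2" "b1 ` I \<subseteq> univ N1" "b2 ` I \<subseteq> univ N2"
    "\<exists>N f1 f2. embedding K f1 N1 N \<and> embedding K f2 N2 N \<and> fixes_pointwise f1 A \<and>
      fixes_pointwise f2 A \<and> (\<forall>i\<in>I. f1 (b1 i) = f2 (b2 i))"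
    using assms by (simp_all add: gtp_atomic_def)
  from *(5) obtain N f1 f2 where **: "embedding K f1 N1 N" "embedding K f2 N2 N"
    "fixes_pointwise f1 A" "fixes_pointwise f2 A" "\<forall>i\<in>I. f1 (b1 i) = f2 (b2 i)"
    by (elim exE conjE)
  show thesis by (rule that[OF *(1-4) **])
qed

lemma sym_gtp_atomic: "sym (gtp_atomic K I A)"
proof (rule symI)
  fix x y assume "(x, y) \<in> gtp_atomic K I A"
  then have "((fst x, snd x), (fst y, snd y)) \<in> gtp_atomic K I A" by simp
  then have "((fst y, snd y), (fst x, snd x)) \<in> gtp_atomic K I A"
  proof (rule gtp_atomicE)
    fix N f1 f2
    assume *: "A \<subseteq> univ (snd x)" "A \<subseteq> univ (snd y)" "fst x ` I \<subseteq> univ (snd x)"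
      "fst y ` I \<subseteq> univ (snd y)" "embedding K f1 (snd x) N" "embedding K f2 (snd y) N"
      "fixes_pointwise f1 A" "fixes_pointwise f2 A" "\<forall>i\<in>I. f1 (fst x i) = f2 (fst y i)"
    show ?thesis
      by (rule gtp_atomicI[OF *(2,1,4,3,6,5,8,7)]) (simp add: *(9))
  qed
  then show "(y, x) \<in> gtp_atomic K I A" by simp
qed

lemma same_type_sym: "same_type I A x y \<Longrightarrow> same_type I A y x"
  using sym_gtp_atomic sym_trancl symD by metis

lemma same_type_trans: "same_type I A x y \<Longrightarrow> same_type I A y z \<Longrightarrow> same_type I A x z"
  by (rule trancl_trans)

text \<open>One atomic step suffices: \<open>N'\<close> itself is the common model, with
  \<open>N\<close> embedded by \<open>g\<close> and \<open>N'\<close> by the identity.\<close>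

lemma same_type_iso:
  assumes "N \<in> models K" "iso (voc K) g N N'" "A \<subseteq> univ N" "fixes_pointwise g A"
    "b ` I \<subseteq> univ N" "\<And>i. i \<in> I \<Longrightarrow> b' i = g (b i)"
  shows "same_type I A (b, N) (b', N')"
proof -
  have A: "A \<subseteq> univ N'"
  proof
    fix x assume "x \<in> A"
    then have "x \<in> univ N" "g x = x" using assms(3,4) by auto
    then show "x \<in> univ N'" using iso_image[OF assms(2)] by force
  qed
  have b': "b' ` I \<subseteq> univ N'"
    using assms(5,6) iso_image[OF assms(2)] by auto
  show ?thesis
    by (intro r_into_trancl gtp_atomicI[OF assms(3) A assms(5) b' embedding_iso[OF assms(1,2)]
      embedding_leK[OF leK_refl[OF iso_models[OF assms(1,2)]]]]) (simp_all add: assms(4,6))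
qed

lemma same_type_leK:
  assumes "leK K N N'" "A \<subseteq> univ N" "b ` I \<subseteq> univ N"
  shows "same_type I A (b, N) (b, N')"
proof -
  have "A \<subseteq> univ N'" "b ` I \<subseteq> univ N'" using assms leK_univ by blast+
  then show ?thesis
    by (intro r_into_trancl gtp_atomicI[OF assms(2) _ assms(3) _ embedding_leK[OF assms(1)]
      embedding_leK[OF leK_refl[OF leK_models2[OF assms(1)]]]]) simp_all
qed

lemma same_type_refl:
  "N \<in> models K \<Longrightarrow> A \<subseteq> univ N \<Longrightarrow> b ` I \<subseteq> univ N \<Longrightarrow> same_type I A (b, N) (b, N)"
  by (simp add: same_type_leK leK_refl)

lemma same_typeD:
  assumes "same_type I A (b, N) (b', N')"
  shows "N \<in> models K" "A \<subseteq> univ N" "b ` I \<subseteq> univ N"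
    "N' \<in> models K" "A \<subseteq> univ N'" "b' ` I \<subseteq> univ N'"
proof -
  have left: "N \<in> models K \<and> A \<subseteq> univ N \<and> b ` I \<subseteq> univ N"
    if "same_type I A (b, N) y" for b N y
  proof -
    from tranclD[OF that] obtain z where "((b, N), z) \<in> gtp_atomic K I A"
      by blast
    then have "((b, N), (fst z, snd z)) \<in> gtp_atomic K I A" by simp
    then show ?thesis by (rule gtp_atomicE) (simp add: embedding_def)
  qed
  from left[OF assms] show "N \<in> models K" "A \<subseteq> univ N" "b ` I \<subseteq> univ N" by auto
  from left[OF same_type_sym[OF assms]]
  show "N' \<in> models K" "A \<subseteq> univ N'" "b' ` I \<subseteq> univ N'" by auto
qed

text \<open>The side conditions put \<open>(b, N)\<close> into its own class. Without them the class
  is empty, and two empty classes are equal although their representatives are unrelated.\<close>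

lemma gtp_eq_iff:
  assumes "N \<in> models K" "A \<subseteq> univ N" "b ` I \<subseteq> univ N"
  shows "gtp K I b A N = gtp K I b' A N' \<longleftrightarrow> same_type I A (b, N) (b', N')"
proof
  assume "gtp K I b A N = gtp K I b' A N'"
  moreover have "(b, N) \<in> gtp K I b A N"
    using same_type_refl[OF assms] by (auto simp: gtp_def)
  ultimately show "same_type I A (b, N) (b', N')"
    by (auto simp: gtp_def intro: same_type_sym)
next
  assume "same_type I A (b, N) (b', N')"
  then show "gtp K I b A N = gtp K I b' A N'"
    unfolding gtp_def using same_type_sym same_type_trans by blast
qed

text \<open>Embeddings that identify two tuples and fix \<open>A\<close> also identify any tuples
  assembled in the same way from their entries and from elements of \<open>A\<close>. Restricting
  the base, rearranging coordinates and turning parameters into entries are all instances.\<close>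

lemma same_type_reindex:
  assumes "same_type I A (b1, N1) (b2, N2)"
    and "B \<subseteq> A"
    and entries: "\<And>j. j \<in> J \<Longrightarrow> (\<exists>i\<in>I. c1 j = b1 i \<and> c2 j = b2 i) \<or> (c1 j = c2 j \<and> c1 j \<in> A)"
  shows "same_type J B (c1, N1) (c2, N2)"
proof -
  \<comment> \<open>\<open>Inl\<close> marks an entry and \<open>Inr\<close> a parameter. The
    resulting recipe \<open>h\<close> does not depend on the tuple, so it applies to every
    intermediate realization in the transitive closure.\<close>
  have "\<forall>j\<in>J. \<exists>z \<in> I <+> A. c1 j = case_sum b1 (\<lambda>x. x) z \<and> c2 j = case_sum b2 (\<lambda>x. x) z"
  proof
    fix j assume "j \<in> J"
    from entries[OF this] show "\<exists>z \<in> I <+> A. c1 j = case_sum b1 (\<lambda>x. x) z \<and> c2 j = case_sum b2 (\<lambda>x. x) z"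
    proof (elim disjE bexE conjE)
      fix i assume "i \<in> I" "c1 j = b1 i" "c2 j = b2 i"
      then show ?thesis by (intro bexI[of _ "Inl i"]) auto
    next
      assume "c1 j = c2 j" "c1 j \<in> A"
      then show ?thesis by (intro bexI[of _ "Inr (c1 j)"]) auto
    qed
  qed
  then obtain h where h: "\<And>j. j \<in> J \<Longrightarrow> h j \<in> I <+> A"
    "\<And>j. j \<in> J \<Longrightarrow> c1 j = case_sum b1 (\<lambda>x. x) (h j)"
    "\<And>j. j \<in> J \<Longrightarrow> c2 j = case_sum b2 (\<lambda>x. x) (h j)"
    by (metis (no_types, lifting) bchoice)
  let ?c = "\<lambda>b j. case_sum b (\<lambda>x. x) (h j)"
  have atomic: "((?c b, N), (?c b', N')) \<in> gtp_atomic K J B"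
    if at: "((b, N), (b', N')) \<in> gtp_atomic K I A" for b b' N N'
  proof -
    obtain f P f' where *:
      "A \<subseteq> univ N" "A \<subseteq> univ N'" "b ` I \<subseteq> univ N" "b' ` I \<subseteq> univ N'"
      "embedding K f N P" "embedding K f' N' P" "fixes_pointwise f A" "fixes_pointwise f' A"
      "\<forall>i\<in>I. f (b i) = f' (b' i)"
      using at by (rule gtp_atomicE)
    have c: "?c b j \<in> univ N \<and> ?c b' j \<in> univ N' \<and> f (?c b j) = f' (?c b' j)" if "j \<in> J" for j
      using h(1)[OF that]
    proof (rule PlusE)
      fix i assume "i \<in> I" "h j = Inl i"
      then show ?thesis using *(3,4,9) by (simp add: image_subset_iff)
    next
      fix x assume "x \<in> A" "h j = Inr x"
      then show ?thesis using *(1,2,7,8) by (simp add: subset_iff)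
    qed
    show ?thesis
    proof (rule gtp_atomicI[OF _ _ _ _ *(5,6)])
      show "B \<subseteq> univ N" "B \<subseteq> univ N'" using *(1,2) assms(2) by blast+
      show "?c b ` J \<subseteq> univ N" "?c b' ` J \<subseteq> univ N'"
        unfolding image_subset_iff using c by blast+
      show "fixes_pointwise f B" "fixes_pointwise f' B" using *(7,8) assms(2) by blast+
    qed (simp add: c)
  qed
  have "same_type J B (?c b1, N1) (?c (fst y), snd y)" if "same_type I A (b1, N1) y" for y
    using that
  proof (induction rule: trancl_induct)
    case (base y)
    then have "((b1, N1), (fst y, snd y)) \<in> gtp_atomic K I A" by simp
    then show ?case by (intro r_into_trancl atomic)
  next
    case (step y z)
    have "((fst y, snd y), (fst z, snd z)) \<in> gtp_atomic K I A" using step(2) by simp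
    from trancl_into_trancl[OF step(3) atomic[OF this]] show ?case .
  qed
  from this[OF assms(1)] have c: "same_type J B (?c b1, N1) (?c b2, N2)"
    by (simp only: fst_conv snd_conv)
  \<comment> \<open>\<open>c1\<close> and \<open>c2\<close> equal the assembled tuples only on
    \<open>J\<close>; as functions they may differ elsewhere.\<close>
  have agree: "same_type J B (d, N) (d', N)"
    if "N \<in> models K" "B \<subseteq> univ N" "d' ` J \<subseteq> univ N" "\<And>j. j \<in> J \<Longrightarrow> d j = d' j" for d d' N
    by (rule same_type_sym, rule same_type_iso[OF that(1) iso_id[OF structure_models[OF that(1)]]])
      (use that in auto)
  have "same_type J B (c1, N1) (?c b1, N1)" "same_type J B (c2, N2) (?c b2, N2)"
    by (rule agree; use same_typeD[OF c] h(2,3) in blast)+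
  then show ?thesis
    using c same_type_trans same_type_sym by blast
qed

lemma same_type_mono:
  assumes "same_type I A (b1, N1) (b2, N2)" "B \<subseteq> A"
  shows "same_type I B (b1, N1) (b2, N2)"
  by (rule same_type_reindex[OF assms]) blast

text \<open>Renaming the second model makes its entries at \<open>J\<close> coincide with those of
  \<open>b1\<close>, which can then serve as parameters. This is the converse of turning parameters
  into entries.\<close>

lemma same_type_to_parameters:
  assumes "same_type I {} (b1, N1) (b2, N2)" "J \<subseteq> I"
  obtains g N2' where "iso (voc K) g N2 N2'" "\<forall>j\<in>J. g (b2 j) = b1 j"
    "same_type I (b1 ` J) (b1, N1) (g \<circ> b2, N2')"
proof -
  have atomic: "\<exists>g N2'. iso (voc K) g N2 N2' \<and> (\<forall>j\<in>J. g (b2 j) = b1 j) \<and>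
      same_type I (b1 ` J) (b1, N1) (g \<circ> b2, N2')"
    if at: "((b1, N1), (b2, N2)) \<in> gtp_atomic K I {}" for b1 N1 b2 N2
  proof -
    obtain f1 N f2 where *: "b1 ` I \<subseteq> univ N1" "b2 ` I \<subseteq> univ N2"
      "embedding K f1 N1 N" "embedding K f2 N2 N" "\<forall>i\<in>I. f1 (b1 i) = f2 (b2 i)"
      using at by (rule gtp_atomicE) (rule that)
    obtain s N' where s: "iso (voc K) s N N'" "leK K N1 N'" "\<And>x. x \<in> univ N1 \<Longrightarrow> s (f1 x) = x"
      using embedding_rename[OF *(3)] by metis
    obtain P where P: "iso (voc K) f2 N2 P" "leK K P N"
      using *(4) by (auto simp: embedding_def)
    \<comment> \<open>The map \<open>s \<circ> f2\<close> moves \<open>N2\<close> into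
      \<open>N'\<close>, which extends \<open>N1\<close> itself; there the identification of the two
      tuples is literal equality.\<close>
    let ?g = "s \<circ> f2" and ?N2 = "image_struct (voc K) s P"
    have g: "iso (voc K) ?g N2 ?N2" and le: "leK K ?N2 N'"
      using leK_image[OF P(2) s(1)] iso_comp[OF P(1)] by auto
    have eq: "?g (b2 i) = b1 i" if "i \<in> I" for i
    proof -
      have "?g (b2 i) = s (f1 (b1 i))" using that *(5) by simp
      also have "\<dots> = b1 i" using that *(1) s(3) by (simp add: image_subset_iff)
      finally show ?thesis .
    qed
    have b2: "(?g \<circ> b2) ` I \<subseteq> univ ?N2"
      using iso_image[OF g] *(2) by auto
    have "((b1, N1), (?g \<circ> b2, ?N2)) \<in> gtp_atomic K I (b1 ` J)"
    proof (rule gtp_atomicI[OF _ _ *(1) b2 embedding_leK[OF s(2)] embedding_leK[OF le]])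
      show "b1 ` J \<subseteq> univ N1" using *(1) assms(2) by blast
      have "(?g \<circ> b2) ` J = b1 ` J" using eq assms(2) by (intro image_cong) auto
      then show "b1 ` J \<subseteq> univ ?N2" using b2 assms(2) by blast
    qed (simp_all add: eq[unfolded comp_def])
    then have "same_type I (b1 ` J) (b1, N1) (?g \<circ> b2, ?N2)" by (rule r_into_trancl)
    moreover have "\<forall>j\<in>J. ?g (b2 j) = b1 j" using eq assms(2) by blast
    ultimately show ?thesis using g by blast
  qed
  have "\<exists>g N2'. iso (voc K) g (snd y) N2' \<and> (\<forall>j\<in>J. g (fst y j) = b1 j) \<and>
      same_type I (b1 ` J) (b1, N1) (g \<circ> fst y, N2')" if "same_type I {} (b1, N1) y" for y
    using that
  proof (induction rule: trancl_induct)
    case (base y)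
    then have "((b1, N1), (fst y, snd y)) \<in> gtp_atomic K I {}" by simp
    then show ?case by (rule atomic)
  next
    case (step y z)
    obtain g N' where g: "iso (voc K) g (snd y) N'" "\<And>j. j \<in> J \<Longrightarrow> g (fst y j) = b1 j"
      "same_type I (b1 ` J) (b1, N1) (g \<circ> fst y, N')"
      using step.IH by blast
    have "((fst y, snd y), (fst z, snd z)) \<in> gtp_atomic K I {}" using step(2) by simp
    then obtain f1 N f2 where *: "fst y ` I \<subseteq> univ (snd y)" "fst z ` I \<subseteq> univ (snd z)"
      "embedding K f1 (snd y) N" "embedding K f2 (snd z) N"
      "\<forall>i\<in>I. f1 (fst y i) = f2 (fst z i)"
      by (rule gtp_atomicE) (rule that)
    have ymod: "snd y \<in> models K" using *(3) by (simp add: embedding_def)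
    \<comment> \<open>The induction hypothesis has renamed the model of \<open>y\<close> by
      \<open>g\<close>. Composing with the inverse lets the next atomic step start from the renamed
      realization, whose entries at \<open>J\<close> are those of \<open>b1\<close>.\<close>
    let ?k = "inv_into (univ (snd y)) g"
    have "embedding K (f1 \<circ> ?k) N' N"
      using embedding_comp[OF embedding_iso *(3)] iso_inv[OF g(1)] iso_models[OF ymod g(1)]
      by blast
    moreover have "(f1 \<circ> ?k) ((g \<circ> fst y) i) = f2 (fst z i)" if "i \<in> I" for i
      using that *(1,5) iso_inj_on[OF g(1)] by (simp add: image_subset_iff)
    moreover have "(g \<circ> fst y) ` I \<subseteq> univ N'"
      using iso_image[OF g(1)] *(1) by auto
    ultimately have "((g \<circ> fst y, N'), (fst z, snd z)) \<in> gtp_atomic K I {}"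
      by (intro gtp_atomicI[OF _ _ _ *(2) _ *(4)]) (simp_all add: comp_def)
    then obtain g' N'' where g': "iso (voc K) g' (snd z) N''"
      "\<forall>j\<in>J. g' (fst z j) = (g \<circ> fst y) j"
      "same_type I ((g \<circ> fst y) ` J) (g \<circ> fst y, N') (g' \<circ> fst z, N'')"
      using atomic by blast
    have img: "(g \<circ> fst y) ` J = b1 ` J" using g(2) by simp
    have "same_type I (b1 ` J) (b1, N1) (g' \<circ> fst z, N'')"
      using same_type_trans[OF g(3)] g'(3) unfolding img by blast
    moreover have "\<forall>j\<in>J. g' (fst z j) = b1 j" using g'(2) g(2) by simp
    ultimately show ?case using g'(1) by blast
  qed
  from this[OF assms(1)] show thesis using that by auto
qed

text \<open>Conjugating the common embeddings by a permutation that extends \<open>g\<close> on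
  \<open>A\<close> gives common embeddings of the renamed models. The two renamings need to agree on
  \<open>A\<close> only.\<close>

lemma same_type_equivariant:
  fixes b b1 :: "'i \<Rightarrow> 'a"
  assumes "same_type I A (b, N) (b1, N1)"
    and "iso (voc K) g N N'" "iso (voc K) g1 N1 N1'" "\<And>x. x \<in> A \<Longrightarrow> g1 x = g x"
  shows "same_type I (g ` A) (g \<circ> b, N') (g1 \<circ> b1, N1')"
proof -
  have atomic: "same_type I (g ` A) (g \<circ> b, N') (g1 \<circ> b1, N1')"
    if at: "((b, N), (b1, N1)) \<in> gtp_atomic K I A"
      and g: "iso (voc K) g N N'" and g1: "iso (voc K) g1 N1 N1'" and eq: "\<And>x. x \<in> A \<Longrightarrow> g1 x = g x"
    for g g1 :: "'a \<Rightarrow> 'a" and b b1 :: "'i \<Rightarrow> 'a" and N N' N1 N1'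
  proof -
    obtain f P f1 where *:
      "A \<subseteq> univ N" "A \<subseteq> univ N1" "b ` I \<subseteq> univ N" "b1 ` I \<subseteq> univ N1"
      "embedding K f N P" "embedding K f1 N1 P" "fixes_pointwise f A" "fixes_pointwise f1 A"
      "\<forall>i\<in>I. f (b i) = f1 (b1 i)"
      using at by (rule gtp_atomicE)
    have NN: "N \<in> models K" "N1 \<in> models K" "P \<in> models K"
      using *(5,6) embedding_models by blast+
    have "small A"
      using small_models[OF NN(1)] card_of_mono1[OF *(1)] ordLeq_ordLess_trans
      unfolding small_def by blast
    moreover have "inj_on g A" using iso_inj_on[OF g] *(1) inj_on_subset by blast
    ultimately obtain s where s: "bij s" "\<And>x. x \<in> A \<Longrightarrow> s x = g x"
      using bij_extension[OF infinite_UNIV] by metis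
    have "inj_on s (univ P)" using s(1) by (meson bij_def inj_on_subset subset_UNIV)
    then have sP: "embedding K s P (image_struct (voc K) s P)"
      using embedding_iso iso_image_struct structure_models NN(3) by blast
    let ?k = "inv_into (univ N) g" and ?k1 = "inv_into (univ N1) g1"
    have k: "?k (g x) = x" if "x \<in> univ N" for x
      using that iso_inj_on[OF g] by simp
    have k1: "?k1 (g1 x) = x" if "x \<in> univ N1" for x
      using that iso_inj_on[OF g1] by simp
    have emb: "embedding K (s \<circ> (f \<circ> ?k)) N' (image_struct (voc K) s P)"
      "embedding K (s \<circ> (f1 \<circ> ?k1)) N1' (image_struct (voc K) s P)"
      using embedding_comp[OF embedding_comp[OF embedding_iso *(5)] sP]
        embedding_comp[OF embedding_comp[OF embedding_iso *(6)] sP]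
        iso_inv[OF g] iso_inv[OF g1] iso_models NN g g1 by blast+
    have A: "g ` A \<subseteq> univ N'" "g ` A = g1 ` A" "g1 ` A \<subseteq> univ N1'"
      using *(1,2) iso_image[OF g] iso_image[OF g1] eq by (blast, simp, blast)
    have "((g \<circ> b, N'), (g1 \<circ> b1, N1')) \<in> gtp_atomic K I (g ` A)"
    proof (rule gtp_atomicI[OF _ _ _ _ emb])
      show "g ` A \<subseteq> univ N'" "g ` A \<subseteq> univ N1'" using A by auto
      show "(g \<circ> b) ` I \<subseteq> univ N'" "(g1 \<circ> b1) ` I \<subseteq> univ N1'"
        using *(3,4) iso_image[OF g] iso_image[OF g1] by (metis image_comp image_mono)+
      show "fixes_pointwise (s \<circ> (f \<circ> ?k)) (g ` A)"
        using *(1,7) k s(2) by (simp add: subset_iff)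
      show "fixes_pointwise (s \<circ> (f1 \<circ> ?k1)) (g ` A)"
      proof -
        have "?k1 (g x) = x" if "x \<in> A" for x
          using k1[of x] eq[OF that] *(2) that by auto
        then show ?thesis using *(8) s(2) by simp
      qed
      fix i assume "i \<in> I"
      then show "(s \<circ> (f \<circ> ?k)) ((g \<circ> b) i) = (s \<circ> (f1 \<circ> ?k1)) ((g1 \<circ> b1) i)"
        using *(3,4,9) k k1 by (simp add: image_subset_iff)
    qed
    then show ?thesis by (rule r_into_trancl)
  qed
  have "\<forall>g1 N1'. iso (voc K) g1 (snd y) N1' \<longrightarrow> (\<forall>x\<in>A. g1 x = g x) \<longrightarrow>
      same_type I (g ` A) (g \<circ> b, N') (g1 \<circ> fst y, N1')" if "same_type I A (b, N) y" for y
    using that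
  proof (induction rule: trancl_induct)
    case (base y)
    then have "((b, N), (fst y, snd y)) \<in> gtp_atomic K I A" by simp
    from atomic[OF this assms(2)] show ?case by blast
  next
    case (step y z)
    have y0: "same_type I A (b, N) (fst y, snd y)" using step(1) by simp
    have y: "A \<subseteq> univ (snd y)" "snd y \<in> models K" "A \<subseteq> univ N"
      using same_typeD[OF y0] by simp_all
    \<comment> \<open>The intermediate model comes with no renaming of its own; a permutation
      extending \<open>g\<close> on \<open>A\<close> supplies one.\<close>
    have "inj_on g A" using iso_inj_on[OF assms(2)] y(3) inj_on_subset by blast
    moreover have "small A"
      using small_models[OF y(2)] card_of_mono1[OF y(1)] ordLeq_ordLess_trans
      unfolding small_def by blast
    ultimately obtain s where s: "bij s" "\<And>x. x \<in> A \<Longrightarrow> s x = g x"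
      using bij_extension[OF infinite_UNIV] by metis
    have "inj_on s (univ (snd y))" using s(1) by (meson bij_def inj_on_subset subset_UNIV)
    then have iso: "iso (voc K) s (snd y) (image_struct (voc K) s (snd y))"
      using iso_image_struct structure_models y(2) by blast
    have 1: "same_type I (g ` A) (g \<circ> b, N') (s \<circ> fst y, image_struct (voc K) s (snd y))"
      using step(3) iso s(2) by blast
    have at: "((fst y, snd y), (fst z, snd z)) \<in> gtp_atomic K I A" using step(2) by simp
    have sg: "s ` A = g ` A" using s(2) by simp
    show ?case
    proof (intro allI impI)
      fix g1 N1' assume "iso (voc K) g1 (snd z) N1'" "\<forall>x\<in>A. g1 x = g x"
      then have "same_type I (s ` A) (s \<circ> fst y, image_struct (voc K) s (snd y)) (g1 \<circ> fst z, N1')"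
        using s(2) by (intro atomic[OF at iso]) auto
      then show "same_type I (g ` A) (g \<circ> b, N') (g1 \<circ> fst z, N1')"
        using 1 same_type_trans unfolding sg by blast
    qed
  qed
  from this[OF assms(1)] show ?thesis using assms(3,4) by simp
qed

section \<open>Restrictions and images of types, computed on realizations\<close>

lemma restrict_type_gtp:
  assumes "N \<in> models K" "A \<subseteq> univ N" "b ` UNIV \<subseteq> univ N" "univ M0 \<subseteq> A"
  shows "restrict_type K (gtp K UNIV b A N) M0 = gtp K UNIV b (univ M0) N"
proof -
  have "gtp K UNIV b' (univ M0) N' = gtp K UNIV b (univ M0) N"
    if "(b', N') \<in> gtp K UNIV b A N" for b' N'
  proof -
    have "same_type UNIV A (b, N) (b', N')" using that by (simp add: gtp_def)
    then have "same_type UNIV (univ M0) (b, N) (b', N')"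
      using same_type_mono assms(4) by blast
    then show ?thesis
      using gtp_eq_iff[of N "univ M0" b UNIV b' N'] assms by auto
  qed
  moreover have "(b, N) \<in> gtp K UNIV b A N"
    using same_type_refl assms(1-3) by (simp add: gtp_def)
  ultimately show ?thesis
    unfolding restrict_type_def by blast
qed

text \<open>By \<open>same_type_equivariant\<close>, all realizations and all extensions of
  \<open>f\<close> give the same class, so the union in \<open>image_type\<close> collapses.\<close>

lemma image_type_gtp:
  assumes "N \<in> models K" "univ M \<subseteq> univ N" "b ` UNIV \<subseteq> univ N"
    and g: "iso (voc K) g N N'" "\<And>x. x \<in> univ M \<Longrightarrow> g x = f x"
  shows "image_type K f M (gtp K UNIV b (univ M) N) = gtp K UNIV (g \<circ> b) (f ` univ M) N'"
proof -
  have gf: "g ` univ M = f ` univ M" using g(2) by simp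
  have valid: "N' \<in> models K" "f ` univ M \<subseteq> univ N'" "(g \<circ> b) ` UNIV \<subseteq> univ N'"
    using iso_models[OF assms(1) g(1)] iso_image[OF g(1)] assms(2,3) gf
    by (blast, blast, metis image_comp image_mono)
  have eq: "gtp K UNIV (g1 \<circ> b1) (f ` univ M) N1' = gtp K UNIV (g \<circ> b) (f ` univ M) N'"
    if "(b1, N1) \<in> gtp K UNIV b (univ M) N" "iso (voc K) g1 N1 N1'" "\<forall>x\<in>univ M. g1 x = f x"
    for g1 b1 N1 N1'
  proof -
    have "same_type UNIV (univ M) (b, N) (b1, N1)" using that(1) by (simp add: gtp_def)
    from same_type_equivariant[OF this g(1) that(2)]
    have "same_type UNIV (f ` univ M) (g \<circ> b, N') (g1 \<circ> b1, N1')"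
      using that(3) g(2) unfolding gf by simp
    then show ?thesis
      using gtp_eq_iff[OF valid] by metis
  qed
  have "(b, N) \<in> gtp K UNIV b (univ M) N"
    using same_type_refl assms(1-3) by (simp add: gtp_def)
  then have "gtp K UNIV (g \<circ> b) (f ` univ M) N' \<subseteq> image_type K f M (gtp K UNIV b (univ M) N)"
    unfolding image_type_def using g by (intro Sup_upper) blast
  moreover have "image_type K f M (gtp K UNIV b (univ M) N) \<subseteq> gtp K UNIV (g \<circ> b) (f ` univ M) N'"
    unfolding image_type_def
  proof (rule Sup_least)
    fix X
    assume "X \<in> {gtp K UNIV (g1 \<circ> b1) (f ` univ M) N1' | g1 b1 N1 N1'.
      (b1, N1) \<in> gtp K UNIV b (univ M) N \<and> iso (voc K) g1 N1 N1' \<and> (\<forall>x\<in>univ M. g1 x = f x)}"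
    then show "X \<subseteq> gtp K UNIV (g \<circ> b) (f ` univ M) N'"
      using eq by blast
  qed
  ultimately show ?thesis by (rule subset_antisym[rotated])
qed

section \<open>Splitting over small tuples\<close>

text \<open>The option type encodes concatenation, with \<open>None\<close> as the place of
  \<open>x\<close>. This is the relation behind the notion of a good index.\<close>

definition agree_on ::
  "'i rel \<Rightarrow> ('f, 'r, 'a) struct \<Rightarrow> 'a \<Rightarrow> ('i \<Rightarrow> 'a) \<Rightarrow> ('i \<Rightarrow> 'a) \<Rightarrow> bool" where
  "agree_on \<alpha> N x b b' \<longleftrightarrow> same_type (insert None (Some ` Field \<alpha>)) {}
     (case_option x b, N) (case_option x b', N)"

lemma agree_on_parameter:
  assumes "same_type (Field \<alpha>) A (b, N) (b', N)" "x \<in> A"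
  shows "agree_on \<alpha> N x b b'"
  unfolding agree_on_def
  by (rule same_type_reindex[OF assms(1)]) (use assms(2) in auto)

text \<open>As \<open>b\<close> and \<open>b'\<close> lie in \<open>A\<close>, equality of the types
  of \<open>x\<close> and \<open>y\<close> over \<open>A\<close> gives \<open>x b\<close> the type
  of \<open>y b\<close>, and \<open>x b'\<close> the type of \<open>y b'\<close>.\<close>

lemma agree_on_transfer:
  assumes xy: "same_type UNIV A (\<lambda>_ :: unit. x, N) (\<lambda>_. y, N)"
    and b: "b ` Field \<alpha> \<subseteq> A" "b' ` Field \<alpha> \<subseteq> A" and agree: "agree_on \<alpha> N x b b'"
  shows "agree_on \<alpha> N y b b'"
proof -
  have *: "same_type (insert None (Some ` Field \<alpha>)) {} (case_option x c, N) (case_option y c, N)"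
    if "c ` Field \<alpha> \<subseteq> A" for c
    by (rule same_type_reindex[OF xy]) (use that in auto)
  show ?thesis
    using *[OF b(1)] *[OF b(2)] agree same_type_sym same_type_trans
    unfolding agree_on_def by blast
qed

text \<open>Tameness localises the disagreement witnessing the splitting to a model
  \<open>N0\<close> of size \<open>ls\<close> inside \<open>N2\<close>. The tuple \<open>b'\<close>
  enumerates \<open>N0\<close>, and \<open>b\<close> is its preimage under \<open>f\<close>, which
  fixes \<open>M0\<close>.\<close>

lemma splits_witness:
  fixes ls lam :: "'a rel"
  assumes tame: "tame K ls" and ls: "Card_order ls" "ls \<le>o lam"
    and L: "leK K L N" and a: "a \<in> univ N"
    and splits: "splits K lam L (gtp1 K a (univ L) N) M0"
  obtains b b' where "b ` Field ls \<subseteq> univ L" "b' ` Field ls \<subseteq> univ L"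
    "same_type (Field ls) (univ M0) (b, N) (b', N)" "\<not> agree_on ls N a b b'"
proof -
  obtain N1 N2 f where N1: "N1 \<in> models_of_card K lam" "leK K M0 N1" "leK K N1 L"
    and N2: "N2 \<in> models_of_card K lam" "leK K M0 N2" "leK K N2 L"
    and f: "iso (voc K) f N1 N2" "fixes_pointwise f (univ M0)"
    and neq: "image_type K f N1 (restrict_type K (gtp1 K a (univ L) N) N1) \<noteq>
      restrict_type K (gtp1 K a (univ L) N) N2"
    using splits unfolding splits_def by blast
  have N: "N \<in> models K" using leK_models2[OF L] .
  have le: "leK K N1 N" "leK K N2 N" using N1(3) N2(3) L leK_trans by blast+
  have restr: "restrict_type K (gtp1 K a (univ L) N) M = gtp1 K a (univ M) N"
    if "leK K M L" for M
    using restrict_type_gtp[OF N leK_univ[OF L] _ leK_univ[OF that], of "\<lambda>_. a"] a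
    by (simp add: gtp1_def image_subset_iff)
  \<comment> \<open>A permutation \<open>h\<close> extending \<open>f\<close> renames the whole of
    \<open>N\<close>, so that \<open>h a\<close> realizes over \<open>N2\<close> the image of the
    type of \<open>a\<close> over \<open>N1\<close>.\<close>
  have "inj_on f (univ N1)" using iso_inj_on[OF f(1)] .
  then obtain h where h: "bij h" "\<And>x. x \<in> univ N1 \<Longrightarrow> h x = f x"
    using bij_extension[OF infinite_UNIV small_models[OF leK_models1[OF le(1)]]] by metis
  have "inj_on h (univ N)" using h(1) by (meson bij_def inj_on_subset subset_UNIV)
  then obtain N' where hN: "iso (voc K) h N N'"
    using iso_image_struct structure_models[OF N] by blast
  have hN1: "iso (voc K) h N1 N2" using iso_cong[OF f(1)] h(2) by blast
  have le': "leK K N2 N'" using leK_iso[OF le(1) hN hN1] .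
  have N': "N' \<in> models K" using leK_models2[OF le'] .
  have a': "h a \<in> univ N'" using iso_image[OF hN] a by blast
  have "image_type K f N1 (gtp1 K a (univ N1) N) = gtp1 K (h a) (univ N2) N'"
    using image_type_gtp[OF N leK_univ[OF le(1)] _ hN, of "\<lambda>_. a" f] a h(2) iso_image[OF f(1)]
    by (simp add: gtp1_def image_subset_iff comp_def)
  then have "gtp1 K (h a) (univ N2) N' \<noteq> gtp1 K a (univ N2) N"
    using neq restr[OF N1(3)] restr[OF N2(3)] by simp
  moreover have "gtp1 K (h a) (univ N2) N' \<in> gS K N2" "gtp1 K a (univ N2) N \<in> gS K N2"
    using le(2) le' a a' unfolding gS_def by blast+
  moreover have "ls \<le>o |univ N2|"
    using N2(1) ls(2) ordLeq_ordIso_trans ordIso_symmetric unfolding models_of_card_def by blast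
  ultimately obtain N0 where N0: "N0 \<in> models_of_card K ls" "leK K N0 N2"
    and "restrict_type K (gtp1 K (h a) (univ N2) N') N0 \<noteq> restrict_type K (gtp1 K a (univ N2) N) N0"
    using tame leK_models1[OF le(2)] unfolding tame_def by blast
  then have neq0: "gtp1 K (h a) (univ N0) N' \<noteq> gtp1 K a (univ N0) N"
    using restrict_type_gtp[OF N leK_univ[OF le(2)] _ leK_univ[OF N0(2)], of "\<lambda>_. a"] a
      restrict_type_gtp[OF N' leK_univ[OF le'] _ leK_univ[OF N0(2)], of "\<lambda>_. h a"] a'
    by (simp add: gtp1_def image_subset_iff)
  have "|Field ls| =o |univ N0|"
    using N0(1) card_of_Field_ordIso[OF ls(1)] ordIso_symmetric ordIso_transitive
    unfolding models_of_card_def by blast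
  then obtain b' where "bij_betw b' (Field ls) (univ N0)"
    using card_of_ordIso by blast
  then have b': "b' ` Field ls = univ N0" by (simp add: bij_betw_def)
  define b where "b = inv_into (univ N1) f \<circ> b'"
  have N02: "univ N0 \<subseteq> univ N2" using leK_univ[OF N0(2)] .
  have b: "b i \<in> univ N1" "f (b i) = b' i" if "i \<in> Field ls" for i
  proof -
    have "b' i \<in> f ` univ N1" using that b' N02 iso_image[OF f(1)] by blast
    then show "b i \<in> univ N1" "f (b i) = b' i"
      unfolding b_def comp_def by (rule inv_into_into, rule f_inv_into_f)
  qed
  have M0: "univ M0 \<subseteq> univ N1" "univ M0 \<subseteq> univ N2" using leK_univ N1(2) N2(2) by blast+
  have bN1: "b ` Field ls \<subseteq> univ N1" using b(1) by blast
  have b'N2: "b' ` Field ls \<subseteq> univ N2" using b' N02 by blast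
  have "same_type (Field ls) (univ M0) (b, N1) (b', N2)"
    by (rule same_type_iso[OF leK_models1[OF le(1)] f(1) M0(1) f(2) bN1]) (simp add: b)
  then have same: "same_type (Field ls) (univ M0) (b, N) (b', N)"
    using same_type_leK[OF le(1) M0(1) bN1] same_type_leK[OF le(2) M0(2) b'N2]
      same_type_sym same_type_trans by blast
  let ?I = "insert None (Some ` Field ls)"
  have "\<not> agree_on ls N a b b'"
  proof
    assume "agree_on ls N a b b'"
    then have 1: "same_type ?I {} (case_option a b', N) (case_option a b, N)"
      unfolding agree_on_def by (rule same_type_sym)
    \<comment> \<open>As \<open>h\<close> extends \<open>f\<close>, it maps \<open>a b\<close> to
      \<open>(h a) b'\<close>. With the assumed agreement, \<open>a b'\<close> and
      \<open>(h a) b'\<close> then have the same type.\<close>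
    have "same_type ?I {} (case_option a b, N) (case_option (h a) b', N')"
    proof (rule same_type_iso[OF N hN])
      show "case_option a b ` ?I \<subseteq> univ N" using a bN1 leK_univ[OF le(1)] by (simp add: image_subset_iff subset_iff image_image)
      show "case_option (h a) b' i = h (case_option a b i)" if "i \<in> ?I" for i
        using that b h(2) by auto
    qed auto
    \<comment> \<open>The shared entries \<open>b'\<close>, which exhaust \<open>N0\<close>, become
      parameters; the renaming \<open>g\<close> therefore fixes \<open>N0\<close> pointwise.\<close>
    from same_type_trans[OF 1 this]
    obtain g N'' where g: "iso (voc K) g N' N''"
      "\<forall>j\<in>Some ` Field ls. g (case_option (h a) b' j) = case_option a b' j"
      "same_type ?I (case_option a b' ` Some ` Field ls) (case_option a b', N)
        (g \<circ> case_option (h a) b', N'')"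
      by (rule same_type_to_parameters[of _ _ _ _ _ "Some ` Field ls"]) blast
    have img: "case_option a b' ` Some ` Field ls = univ N0"
      using b' by (simp add: image_image)
    have 2: "same_type UNIV (univ N0) (\<lambda>_ :: unit. a, N) (\<lambda>_. g (h a), N'')"
      by (rule same_type_reindex[OF g(3)[unfolded img]]) auto
    have "same_type UNIV (univ N0) (\<lambda>_ :: unit. h a, N') (\<lambda>_. g (h a), N'')"
    proof (rule same_type_iso[OF N' g(1)])
      show "univ N0 \<subseteq> univ N'" using N02 leK_univ[OF le'] by blast
      show "fixes_pointwise g (univ N0)" using g(2) b' by force
    qed (use a' in auto)
    then have 3: "same_type UNIV (univ N0) (\<lambda>_ :: unit. h a, N') (\<lambda>_. a, N)"
      using 2 same_type_sym same_type_trans by blast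
    then have "gtp1 K (h a) (univ N0) N' = gtp1 K a (univ N0) N"
      unfolding gtp1_def by (subst gtp_eq_iff) (use same_typeD[OF 3] in auto)
    with neq0 show False by contradiction
  qed
  moreover have "b ` Field ls \<subseteq> univ L" "b' ` Field ls \<subseteq> univ L"
    using bN1 b'N2 leK_univ[OF N1(3)] leK_univ[OF N2(3)] by blast+
  ultimately show thesis using that same by blast
qed

text \<open>For infinite \<open>\<alpha>\<close>, the elements \<open>x i\<close> and the tuples
  \<open>b i\<close>, \<open>b' i\<close> fit into one tuple \<open>t i\<close> of length
  \<open>\<alpha>\<close>. If an increasing pair \<open>i0, j0\<close> had the type of a reversed
  pair \<open>j1, i1\<close>, the agreement for \<open>x i0\<close> at \<open>j0\<close> would carry
  over to \<open>x j1\<close> at \<open>i1\<close>, which \<open>disagree\<close> excludes.\<close>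

lemma order_propertyI:
  fixes \<alpha> :: "'i rel" and \<theta> :: "'j rel"
  assumes inf: "infinite (Field \<alpha>)" and N: "N \<in> models K"
    and in_N: "\<And>i. i \<in> Field \<theta> \<Longrightarrow> x i \<in> univ N"
      "\<And>i. i \<in> Field \<theta> \<Longrightarrow> b i ` Field \<alpha> \<subseteq> univ N" "\<And>i. i \<in> Field \<theta> \<Longrightarrow> b' i ` Field \<alpha> \<subseteq> univ N"
    and agree: "\<And>i j. (i, j) \<in> \<theta> - Id \<Longrightarrow> agree_on \<alpha> N (x i) (b j) (b' j)"
    and disagree: "\<And>i j. (i, j) \<in> \<theta> - Id \<Longrightarrow> \<not> agree_on \<alpha> N (x j) (b i) (b' i)"
  shows "order_property K \<alpha> \<theta>"
proof -
  let ?S = "(UNIV :: unit set) <+> (Field \<alpha> <+> Field \<alpha>)"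
  have two: "|Field \<alpha> <+> Field \<alpha>| =o |Field \<alpha>|"
    using card_of_Plus_infinite1[OF inf card_of_refl[THEN ordIso_imp_ordLeq]] .
  have "|UNIV :: unit set| \<le>o |Field \<alpha> <+> Field \<alpha>|"
    unfolding UNIV_unit by (rule card_of_singl_ordLeq) (use inf in auto)
  then have "|?S| =o |Field \<alpha> <+> Field \<alpha>|"
    by (intro card_of_Plus_infinite2) (use inf in auto)
  then have "|?S| =o |Field \<alpha>|" using two ordIso_transitive by blast
  then obtain d where d: "bij_betw d ?S (Field \<alpha>)" using card_of_ordIso by blast
  define e where "e = inv_into ?S d"
  have e: "e (d z) = z" if "z \<in> ?S" for z
    unfolding e_def using that d by (simp add: bij_betw_def)
  have e_in: "e k \<in> ?S" if "k \<in> Field \<alpha>" for k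
    using that d inv_into_into[of k d ?S] by (simp add: e_def bij_betw_def)
  have d_in: "d z \<in> Field \<alpha>" if "z \<in> ?S" for z
    using that d by (auto simp: bij_betw_def)
  define t where "t i k = (case e k of Inl _ \<Rightarrow> x i | Inr (Inl m) \<Rightarrow> b i m | Inr (Inr m) \<Rightarrow> b' i m)"
    for i k
  have t_in: "t i ` Field \<alpha> \<subseteq> univ N" if i: "i \<in> Field \<theta>" for i
  proof
    fix y assume "y \<in> t i ` Field \<alpha>"
    then obtain k where k: "k \<in> Field \<alpha>" "y = t i k" by blast
    show "y \<in> univ N"
      using e_in[OF k(1)] in_N[OF i] k(2) by (auto simp: t_def)
  qed
  let ?I = "Field \<alpha> <+> Field \<alpha>" and ?J = "insert None (Some ` Field \<alpha>)"
  \<comment> \<open>From the first tuple of each pair only the \<open>x\<close> part is read, from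
    the second only the \<open>b\<close> and \<open>b'\<close> parts.\<close>
  have components: "same_type ?J {} (case_option (x i0) (b j0), N) (case_option (x j1) (b i1), N)"
    "same_type ?J {} (case_option (x i0) (b' j0), N) (case_option (x j1) (b' i1), N)"
    if "same_type ?I {} (case_sum (t i0) (t j0), N) (case_sum (t j1) (t i1), N)" for i0 j0 i1 j1
  proof -
    have t_d: "t i (d (Inl ())) = x i" for i using e[OF InlI[OF UNIV_I]] by (simp add: t_def)
    have t_d': "t i (d (Inr (Inl m))) = b i m" "t i (d (Inr (Inr m))) = b' i m" if "m \<in> Field \<alpha>" for i m
      using e[OF InrI[OF InlI[OF that]]] e[OF InrI[OF InrI[OF that]]] by (simp_all add: t_def)
    define k0 where "k0 = d (Inl ())"
    have k0: "k0 \<in> Field \<alpha>" "\<And>i. t i k0 = x i"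
      using t_d d_in[OF InlI[OF UNIV_I]] by (simp_all add: k0_def)
    have None: "\<exists>i\<in>?I. x i0 = case_sum (t i0) (t j0) i \<and> x j1 = case_sum (t j1) (t i1) i"
      by (rule bexI[of _ "Inl k0"]) (use k0 in auto)
    have Some: "\<exists>i\<in>?I. b j0 m = case_sum (t i0) (t j0) i \<and> b i1 m = case_sum (t j1) (t i1) i"
      "\<exists>i\<in>?I. b' j0 m = case_sum (t i0) (t j0) i \<and> b' i1 m = case_sum (t j1) (t i1) i"
      if "m \<in> Field \<alpha>" for m
    proof -
      define k k2 where "k = d (Inr (Inl m))" and "k2 = d (Inr (Inr m))"
      then have k: "k \<in> Field \<alpha>" "\<And>i. t i k = b i m" and k2: "k2 \<in> Field \<alpha>" "\<And>i. t i k2 = b' i m"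
        using t_d'[OF that] d_in[OF InrI[OF InlI[OF that]]] d_in[OF InrI[OF InrI[OF that]]]
        by simp_all
      show "\<exists>i\<in>?I. b j0 m = case_sum (t i0) (t j0) i \<and> b i1 m = case_sum (t j1) (t i1) i"
        by (rule bexI[of _ "Inr k"]) (use k in auto)
      show "\<exists>i\<in>?I. b' j0 m = case_sum (t i0) (t j0) i \<and> b' i1 m = case_sum (t j1) (t i1) i"
        by (rule bexI[of _ "Inr k2"]) (use k2 in auto)
    qed
    have "same_type ?J {} (case_option (x i0) (c j0), N) (case_option (x j1) (c i1), N)"
      if c: "\<And>m. m \<in> Field \<alpha> \<Longrightarrow>
        \<exists>i\<in>?I. c j0 m = case_sum (t i0) (t j0) i \<and> c i1 m = case_sum (t j1) (t i1) i" for c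
    proof (rule same_type_reindex[OF \<open>same_type ?I {} _ _\<close> subset_refl], rule disjI1)
      fix j assume "j \<in> ?J"
      then show "\<exists>i\<in>?I. case_option (x i0) (c j0) j = case_sum (t i0) (t j0) i \<and>
          case_option (x j1) (c i1) j = case_sum (t j1) (t i1) i"
      proof (rule insertE)
        assume "j = None"
        then show ?thesis unfolding \<open>j = None\<close> option.case by (intro None)
      next
        assume "j \<in> Some ` Field \<alpha>"
        then obtain m where "j = Some m" "m \<in> Field \<alpha>" by blast
        then show ?thesis unfolding \<open>j = Some m\<close> option.case by (intro c)
      qed
    qed
    from this[of b, OF Some(1)] this[of b', OF Some(2)]
    show "same_type ?J {} (case_option (x i0) (b j0), N) (case_option (x j1) (b i1), N)"
      "same_type ?J {} (case_option (x i0) (b' j0), N) (case_option (x j1) (b' i1), N)"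
      by auto
  qed
  have "gtp K ?I (case_sum (t i0) (t j0)) {} N \<noteq> gtp K ?I (case_sum (t j1) (t i1)) {} N"
    if 0: "(i0, j0) \<in> \<theta> - Id" and 1: "(i1, j1) \<in> \<theta> - Id" for i0 j0 i1 j1
  proof
    assume eq: "gtp K ?I (case_sum (t i0) (t j0)) {} N = gtp K ?I (case_sum (t j1) (t i1)) {} N"
    have "i0 \<in> Field \<theta>" "j0 \<in> Field \<theta>" using 0 by (auto simp: Field_def)
    then have t: "t i0 ` Field \<alpha> \<subseteq> univ N" "t j0 ` Field \<alpha> \<subseteq> univ N" using t_in by auto
    have "case_sum (t i0) (t j0) ` ?I \<subseteq> univ N"
    proof (rule image_subsetI)
      fix z assume "z \<in> ?I"
      then show "case_sum (t i0) (t j0) z \<in> univ N"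
        by (rule PlusE) (use t in \<open>simp_all add: image_subset_iff\<close>)
    qed
    then have "same_type ?I {} (case_sum (t i0) (t j0), N) (case_sum (t j1) (t i1), N)"
      using eq gtp_eq_iff[OF N empty_subsetI] by metis
    note c = components[OF this]
    have "same_type ?J {} (case_option (x j1) (b i1), N) (case_option (x j1) (b' i1), N)"
      by (rule same_type_trans[OF same_type_sym[OF c(1)]],
          rule same_type_trans[OF agree[OF 0, unfolded agree_on_def] c(2)])
    with disagree[OF 1] show False unfolding agree_on_def by contradiction
  qed
  then show ?thesis
    unfolding order_property_def using N t_in
    by (intro bexI[of _ N] exI[of _ t] conjI ballI allI impI) (simp_all only: not_False_eq_True)
qed

section \<open>Limit models\<close>

lemma LS_Cinfinite:
  assumes "LS_property K \<mu>" "Card_order \<kappa>" "\<mu> \<le>o \<kappa>"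
  shows "Cinfinite \<kappa>"
proof -
  have "natLeq \<le>o \<mu>" using assms(1) by (simp add: LS_property_def)
  then show ?thesis
    using assms(2,3) ordLeq_transitive cinfinite_mono natLeq_cinfinite by blast
qed

lemma LS_submodel:
  assumes LS: "LS_property K \<mu>" and \<kappa>: "Card_order \<kappa>" "\<mu> \<le>o \<kappa>"
    and M: "M \<in> models K" and A: "A \<subseteq> univ M" "|A| \<le>o \<kappa>"
  obtains M0 where "leK K M0 M" "A \<subseteq> univ M0" "|univ M0| \<le>o \<kappa>"
proof -
  have "Card_order \<mu>" using LS by (simp add: LS_property_def)
  then have bound: "|A| +c \<mu> \<le>o \<kappa>"
    using csum_cinfinite_bound A(2) \<kappa> LS_Cinfinite[OF LS \<kappa>] card_of_Card_order by blast
  obtain M0 where "leK K M0 M" "A \<subseteq> univ M0" "|univ M0| \<le>o |A| +c \<mu>"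
    using LS M A(1) unfolding LS_property_def by blast
  then show thesis using that bound ordLeq_transitive by blast
qed

text \<open>Amalgamate \<open>M'\<close> with \<open>M1\<close> over \<open>M0\<close>, renamed so
  that \<open>M1\<close> is included in the amalgam, and apply universality over
  \<open>M1\<close>.\<close>

lemma universal_over_submodel:
  fixes lam \<mu> :: "'a rel"
  assumes amalg: "amalgamation K" and LS: "LS_property K \<mu>" and lam: "Card_order lam" "\<mu> \<le>o lam"
    and le: "leK K M0 M1" and M0: "M0 \<in> models_of_card K lam"
    and univ: "universal_over K lam N M1"
  shows "universal_over K lam N M0"
proof -
  have M1: "M1 \<in> models_of_card K lam" and N: "N \<in> models_of_card K lam" "leK K M1 N"
    and ex: "\<And>M'. M' \<in> models_of_card K lam \<Longrightarrow> leK K M1 M' \<Longrightarrow>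
        \<exists>f. embedding K f M' N \<and> fixes_pointwise f (univ M1)"
    using univ unfolding universal_over_def by blast+
  have "\<exists>f. embedding K f M' N \<and> fixes_pointwise f (univ M0)"
    if M': "M' \<in> models_of_card K lam" "leK K M0 M'" for M'
  proof -
    obtain P g h where g: "embedding K g M' P" "fixes_pointwise g (univ M0)"
      and h: "embedding K h M1 P" "fixes_pointwise h (univ M0)"
      using amalg M'(2) le unfolding amalgamation_def by blast
    obtain s P' where s: "iso (voc K) s P P'" "leK K M1 P'" "\<And>x. x \<in> univ M1 \<Longrightarrow> s (h x) = x"
      using embedding_rename[OF h(1)] by metis
    have P: "P \<in> models K" using embedding_models[OF g(1)] by blast
    have sg: "embedding K (s \<circ> g) M' P'"
      using embedding_comp[OF g(1) embedding_iso[OF P s(1)]] .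
    \<comment> \<open>Universality speaks of models of size \<open>lam\<close>, while the amalgam
      may be larger; \<open>Q\<close> is a submodel of the right size containing \<open>M1\<close>
      and the image of \<open>M'\<close>.\<close>
    let ?A = "(s \<circ> g) ` univ M' \<union> univ M1"
    have card: "|univ M'| =o lam" "|univ M1| =o lam"
      using M'(1) M1 by (auto simp: models_of_card_def)
    have inf: "infinite (Field lam)"
      using LS_Cinfinite[OF LS lam] by (simp add: cinfinite_def)
    have "|(s \<circ> g) ` univ M'| \<le>o lam"
      using card_of_image ordLeq_ordIso_trans card(1) by blast
    then have A: "|?A| \<le>o lam"
      using card_of_Un_ordLeq_infinite_Field[OF inf _ _ lam(1)] card(2) ordIso_imp_ordLeq by blast
    have "?A \<subseteq> univ P'" using embedding_image_subset[OF sg] leK_univ[OF s(2)] by blast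
    then obtain Q where Q: "leK K Q P'" "?A \<subseteq> univ Q" "|univ Q| \<le>o lam"
      using LS_submodel[OF LS lam leK_models2[OF s(2)] _ A] by blast
    have MQ: "leK K M1 Q" using leK_coherence[OF s(2) Q(1)] Q(2) by blast
    have "lam \<le>o |univ Q|"
      using card(2) card_of_mono1[OF leK_univ[OF MQ]] ordIso_symmetric ordIso_ordLeq_trans by blast
    then have "Q \<in> models_of_card K lam"
      using Q leK_models1 ordIso_iff_ordLeq unfolding models_of_card_def by blast
    then obtain k where k: "embedding K k Q N" "fixes_pointwise k (univ M1)"
      using ex MQ by blast
    obtain R where R: "iso (voc K) (s \<circ> g) M' R" "leK K R P'"
      using sg by (auto simp: embedding_def)
    have "leK K R Q" using leK_coherence[OF R(2) Q(1)] Q(2) iso_image[OF R(1)] by blast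
    then have "embedding K (s \<circ> g) M' Q"
      using R(1) sg unfolding embedding_def by blast
    then have "embedding K (k \<circ> (s \<circ> g)) M' N" using embedding_comp k(1) by blast
    moreover have "(k \<circ> (s \<circ> g)) x = x" if "x \<in> univ M0" for x
    proof -
      have "x \<in> univ M1" using that leK_univ[OF le] by blast
      moreover have "s (g x) = x" using that g(2) h(2) s(3)[OF calculation] by simp
      ultimately show ?thesis using k(2) by simp
    qed
    ultimately show ?thesis by blast
  qed
  then show ?thesis
    using M0 N leK_trans[OF le N(2)] unfolding universal_over_def by blast
qed

text \<open>For mutually cofinal chains, the chain axioms make each union a strong submodel of the
  other.\<close>

lemma union_struct_cong:
  fixes r s :: "'a rel"
  assumes "limit_order r" "increasing_chain K r M" "small (\<Union>i\<in>Field r. univ (M i))"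
    and "limit_order s" "increasing_chain K s N" "small (\<Union>i\<in>Field s. univ (N i))"
    and MN: "\<And>i. i \<in> Field r \<Longrightarrow> \<exists>j\<in>Field s. leK K (M i) (N j)"
    and NM: "\<And>j. j \<in> Field s \<Longrightarrow> \<exists>i\<in>Field r. leK K (N j) (M i)"
  shows "union_struct (M ` Field r) = union_struct (N ` Field s)"
proof (rule substructure_antisym)
  note r = union_struct_chain[OF assms(1-3)] and s = union_struct_chain[OF assms(4-6)]
  show "substructure (voc K) (union_struct (M ` Field r)) (union_struct (N ` Field s))"
    by (rule leK_substructure, rule r(3)) (use MN s(2) leK_trans in blast)
  show "substructure (voc K) (union_struct (N ` Field s)) (union_struct (M ` Field r))"
    by (rule leK_substructure, rule s(3)) (use NM r(2) leK_trans in blast)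
qed

text \<open>The models at limit indices are replaced by the unions below them. The new chain is
  continuous and interleaves with the old one, so the total union stays the same.\<close>

lemma limit_model_union:
  fixes r lam \<mu> :: "'a rel"
  assumes amalg: "amalgamation K" and LS: "LS_property K \<mu>" and lam: "Card_order lam" "\<mu> \<le>o lam"
    and lam_small: "lam <o |UNIV :: 'a set|"
    and chain: "universal_chain K lam r M"
  shows "limit_model K lam (union_struct (M ` Field r))"
    and "\<And>i. i \<in> Field r \<Longrightarrow> leK K (M i) (union_struct (M ` Field r))"
    and "univ (union_struct (M ` Field r)) = (\<Union>i\<in>Field r. univ (M i))"
proof -
  have r: "limit_order r" "|Field r| \<le>o lam" "increasing_chain K r M"
    and M: "\<And>i. i \<in> Field r \<Longrightarrow> M i \<in> models_of_card K lam"
    and succ: "\<And>i j. is_succ r i j \<Longrightarrow> universal_over K lam (M j) (M i)"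
    using chain unfolding universal_chain_def by blast+
  have wo: "Well_order r" and nolast: "\<And>i. i \<in> Field r \<Longrightarrow> \<exists>j. (i, j) \<in> r \<and> i \<noteq> j"
    using r(1) unfolding limit_order_def by blast+
  have refl: "\<And>i. i \<in> Field r \<Longrightarrow> (i, i) \<in> r"
    and total: "\<And>i j. i \<in> Field r \<Longrightarrow> j \<in> Field r \<Longrightarrow> (i, j) \<in> r \<or> (j, i) \<in> r"
    using wo_rel.TOTALS[unfolded wo_rel_def, OF wo] by blast+
  have inf: "infinite (Field lam)"
    using LS_Cinfinite[OF LS lam] by (simp add: cinfinite_def)
  have card: "|\<Union>i\<in>I. univ (N i)| \<le>o lam"
    if "I \<subseteq> Field r" "\<And>i. i \<in> I \<Longrightarrow> |univ (N i)| \<le>o lam" for I and N :: "'a \<Rightarrow> ('f, 'r, 'a) struct"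
    by (rule card_of_UNION_ordLeq_infinite_Field[OF inf lam(1)])
      (use that card_of_mono1 r(2) ordLeq_transitive in blast)+
  have MK: "M i \<in> models K" if "i \<in> Field r" for i
    using M[OF that] by (simp add: models_of_card_def)
  have cardM: "|univ (M i)| \<le>o lam" if "i \<in> Field r" for i
    using M[OF that] ordIso_imp_ordLeq by (auto simp: models_of_card_def)
  have small: "small (\<Union>i\<in>I. univ (N i))"
    if "I \<subseteq> Field r" "\<And>i. i \<in> I \<Longrightarrow> |univ (N i)| \<le>o lam" for I and N :: "'a \<Rightarrow> ('f, 'r, 'a) struct"
    unfolding small_def
    by (rule ordLeq_ordLess_trans[OF card lam_small]) (use that in auto)
  show le: "leK K (M i) (union_struct (M ` Field r))" if "i \<in> Field r" for i
    using union_struct_chain(2)[OF r(1,3) small that] cardM by blast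
  show "univ (union_struct (M ` Field r)) = (\<Union>i\<in>Field r. univ (M i))"
    by (simp add: union_struct_def)
  have Mle: "leK K (M i) (M j)" if "(i, j) \<in> r" for i j
    using r(3) that unfolding increasing_chain_def by blast
  \<comment> \<open>The chain axioms speak of whole well-orders, so the segment below
    \<open>j\<close> is made into one by restricting \<open>r\<close>.\<close>
  let ?R = "\<lambda>j. Restr r (underS r j)" and ?U = "\<lambda>j. union_struct (M ` underS r j)"
  have sub: "underS r j \<subseteq> Field r" for j by (auto simp: underS_def Field_def)
  have FieldR: "Field (?R j) = underS r j" for j
    using sub refl by (force simp: Field_def)
  have between: "\<exists>k\<in>underS r j. (i, k) \<in> r \<and> i \<noteq> k" if j: "is_limit_elem r j" and i: "i \<in> underS r j" for i j
  proof -
    have "\<not> is_succ r i j" using j unfolding is_limit_elem_def by blast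
    then obtain k where k: "k \<in> underS r j" "(k, i) \<notin> r"
      using i unfolding is_succ_def by blast
    have "(i, k) \<in> r" using total[of i k] k i sub by blast
    moreover have "i \<noteq> k" using refl[of i] k i sub by blast
    ultimately show ?thesis using k(1) by blast
  qed
  have limR: "limit_order (?R j)" if j: "is_limit_elem r j" for j
    unfolding limit_order_def
  proof (intro conjI ballI)
    show "Well_order (?R j)" by (rule Well_order_Restr[OF wo])
    show "Field (?R j) \<noteq> {}" using j by (simp add: FieldR is_limit_elem_def)
    fix i assume "i \<in> Field (?R j)"
    then have "i \<in> underS r j" by (simp only: FieldR)
    with between[OF j this] show "\<exists>k. (i, k) \<in> ?R j \<and> i \<noteq> k" by blast
  qed
  have incR: "increasing_chain K (?R j) M" for j
    unfolding increasing_chain_def FieldR using Mle MK sub by blast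
  have smallU: "small (\<Union>i\<in>underS r j. univ (M i))" for j
    by (rule small[OF sub]) (use cardM sub in blast)
  note U = union_struct_chain[OF limR incR, unfolded FieldR, OF _ smallU]
  have U3: "leK K (?U j) (M j)" if "is_limit_elem r j" for j
    by (rule U(3)[OF that]) (simp add: Mle underS_def)
  \<comment> \<open>limit models require continuity at limit indices, universal chains do not\<close>
  define M' where "M' j = (if is_limit_elem r j then ?U j else M j)" for j
  have M'M: "leK K (M' j) (M j)" if "j \<in> Field r" for j
    using U3 leK_refl MK[OF that] by (simp add: M'_def)
  have MM': "leK K (M i) (M' j)" if "(i, j) \<in> r" "i \<noteq> j" for i j
    using U(2)[of j i] Mle that by (auto simp: M'_def underS_def)
  \<comment> \<open>At a limit index, the union of at most \<open>lam\<close> models of size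
    \<open>lam\<close> has at most that size, and any one of these models gives the lower
    bound.\<close>
  have M'_card: "M' j \<in> models_of_card K lam" if j: "j \<in> Field r" for j
  proof (cases "is_limit_elem r j")
    case True
    then obtain i where i: "i \<in> underS r j" unfolding is_limit_elem_def by blast
    have "|univ (?U j)| \<le>o lam"
      using card[OF sub, of j M] cardM sub by (simp add: union_struct_def subset_iff)
    moreover have "lam \<le>o |univ (?U j)|"
      using M[of i] i sub card_of_mono1[OF leK_univ[OF U(2)[OF True i]]]
        ordIso_symmetric ordIso_ordLeq_trans unfolding models_of_card_def by blast
    ultimately show ?thesis
      using True U(1)[OF True] ordIso_iff_ordLeq by (auto simp: M'_def models_of_card_def)
  qed (use M[OF j] in \<open>simp add: M'_def\<close>)
  have M'_card_le: "|univ (M' i)| \<le>o lam" if "i \<in> Field r" for i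
    using M'_card[OF that] ordIso_imp_ordLeq by (auto simp: models_of_card_def)
  have M'_le: "leK K (M' i) (M' j)" if "(i, j) \<in> r" for i j
  proof (cases "i = j")
    case True
    have "j \<in> Field r" using that by (auto simp: Field_def)
    then show ?thesis using leK_refl M'_card True by (auto simp: models_of_card_def)
  next
    case False
    then show ?thesis using M'M[of i] MM'[OF that] leK_trans that by (meson FieldI1)
  qed
  have inc': "increasing_chain K r M'"
    unfolding increasing_chain_def using M'_card M'_le by (auto simp: models_of_card_def)
  have inc'R: "increasing_chain K (?R j) M'" for j
    using inc' sub unfolding increasing_chain_def FieldR by blast
  have succ': "universal_over K lam (M' j) (M' i)" if "is_succ r i j" for i j
  proof -
    have "i \<in> underS r j" using that by (simp add: is_succ_def)
    then have "i \<in> Field r" using sub by blast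
    \<comment> \<open>A successor index keeps its model, but its predecessor may be a limit index
      whose model has shrunk; universality survives this by
      \<open>universal_over_submodel\<close>.\<close>
    moreover have "M' j = M j" using that by (auto simp: M'_def is_limit_elem_def)
    ultimately show ?thesis
      using universal_over_submodel[OF amalg LS lam M'M _ succ[OF that]] M'_card by simp
  qed
  have "universal_chain K lam r M'"
    unfolding universal_chain_def using r inc' M'_card succ' by blast
  moreover have "M' j = union_struct (M' ` underS r j)" if j: "is_limit_elem r j" for j
  proof -
    have "?U j = union_struct (M' ` underS r j)"
    proof (rule union_struct_cong[OF limR[OF j] incR _ limR[OF j] inc'R, unfolded FieldR])
      show "small (\<Union>i\<in>underS r j. univ (M i))" "small (\<Union>i\<in>underS r j. univ (M' i))"
        by (rule small[OF sub]; use cardM M'_card_le sub in blast)+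
      show "\<exists>k\<in>underS r j. leK K (M i) (M' k)" if "i \<in> underS r j" for i
        using between[OF j that] MM' by blast
      show "\<exists>k\<in>underS r j. leK K (M' i) (M k)" if "i \<in> underS r j" for i
        using M'M that sub by blast
    qed
    then show ?thesis using j by (simp add: M'_def)
  qed
  moreover have "union_struct (M ` Field r) = union_struct (M' ` Field r)"
  proof (rule union_struct_cong[OF r(1,3) _ r(1) inc'])
    show "small (\<Union>i\<in>Field r. univ (M i))" "small (\<Union>i\<in>Field r. univ (M' i))"
      by (rule small[OF subset_refl]; use cardM M'_card_le in blast)+
    \<comment> \<open>A later index is taken because \<open>M' i\<close> may be properly contained
      in \<open>M i\<close>; it exists since the order has no last element.\<close>
    show "\<exists>j\<in>Field r. leK K (M i) (M' j)" if "i \<in> Field r" for i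
      using nolast[OF that] MM' by (meson FieldI2)
    show "\<exists>i\<in>Field r. leK K (M' j) (M i)" if "j \<in> Field r" for j
      using M'M that by blast
  qed
  ultimately show "limit_model K lam (union_struct (M ` Field r))"
    unfolding limit_model_def by blast
qed

section \<open>From a long splitting chain to the order property\<close>

lemma no_long_splitting_chains_if_limit_models_saturated:
  fixes ls \<theta> \<chi> lam :: "'a rel"
  assumes amalg: "amalgamation K" and LS: "LS_property K ls" and tame: "tame K ls"
    and \<theta>: "Card_order \<theta>" "ls \<le>o \<theta>" "\<not> order_property K ls \<theta>"
    and \<chi>: "\<theta> <o \<chi>" "\<chi> \<le>o lam" and lam: "Card_order lam" "lam <o |UNIV :: 'a set|"
    and sat: "\<And>L. limit_model K lam L \<Longrightarrow> saturated_in K \<chi> L"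
  shows "no_long_splitting_chains K lam"
  unfolding no_long_splitting_chains_def
proof (intro allI impI ballI, rule ccontr)
  fix r :: "'a rel" and M :: "'a \<Rightarrow> ('f, 'r, 'a) struct" and p
  let ?L = "union_struct (M ` Field r)"
  assume chain: "universal_chain K lam r M" and p: "p \<in> gS K ?L"
    and "\<not> (\<exists>i\<in>Field r. \<not> splits K lam ?L p (M i))"
  then have splits: "\<And>i. i \<in> Field r \<Longrightarrow> splits K lam ?L p (M i)" by blast
  have ls: "Card_order ls" using LS by (simp add: LS_property_def)
  then have "ls \<le>o ls" by (rule ordLeq_refl)
  then have inf: "infinite (Field ls)" "infinite (Field \<theta>)"
    using LS_Cinfinite[OF LS ls] LS_Cinfinite[OF LS \<theta>(1,2)] by (simp_all add: cinfinite_def)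
  have ls_lam: "ls \<le>o lam"
    using \<theta>(2) \<chi> ordLeq_ordLess_trans ordLess_ordLeq_trans ordLess_imp_ordLeq by blast
  note limit = limit_model_union[OF amalg LS lam(1) ls_lam lam(2) chain]
  have satL: "saturated_in K \<chi> ?L" using sat limit(1) .
  then have L: "?L \<in> models K" by (simp add: saturated_in_def)
  obtain a N where N: "leK K ?L N" "a \<in> univ N" and p_eq: "p = gtp1 K a (univ ?L) N"
    using p by (auto simp: gS_def)
  have NK: "N \<in> models K" using leK_models2[OF N(1)] .
  have "\<forall>i\<in>Field r. \<exists>b b'. b ` Field ls \<subseteq> univ ?L \<and> b' ` Field ls \<subseteq> univ ?L \<and>
      same_type (Field ls) (univ (M i)) (b, N) (b', N) \<and> \<not> agree_on ls N a b b'"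
  proof
    fix i assume "i \<in> Field r"
    from splits_witness[OF tame ls ls_lam N splits[OF this, unfolded p_eq]]
    show "\<exists>b b'. b ` Field ls \<subseteq> univ ?L \<and> b' ` Field ls \<subseteq> univ ?L \<and>
      same_type (Field ls) (univ (M i)) (b, N) (b', N) \<and> \<not> agree_on ls N a b b'" by metis
  qed
  then obtain b b' where b: "\<And>i. i \<in> Field r \<Longrightarrow> b i ` Field ls \<subseteq> univ ?L"
    and b': "\<And>i. i \<in> Field r \<Longrightarrow> b' i ` Field ls \<subseteq> univ ?L"
    and same: "\<And>i. i \<in> Field r \<Longrightarrow> same_type (Field ls) (univ (M i)) (b i, N) (b' i, N)"
    and a: "\<And>i. i \<in> Field r \<Longrightarrow> \<not> agree_on ls N a (b i) (b' i)"
    by metis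
  \<comment> \<open>\<open>D x i\<close> says that \<open>i\<close> is good for \<open>x\<close>; no
    index is good for \<open>a\<close>.\<close>
  define D where "D x i \<longleftrightarrow> agree_on ls N x (b i) (b' i)" for x i
  have D: "D x i" if "i \<in> Field r" "x \<in> univ (M i)" for x i
    unfolding D_def using agree_on_parameter[OF same[OF that(1)] that(2)] .
  \<comment> \<open>The tuples at indices in \<open>C\<close> lie in a submodel of size at most
    \<open>\<theta>\<close>, hence below \<open>\<chi>\<close>. Saturation realizes the type of
    \<open>a\<close> over it by some \<open>x\<close> in \<open>?L\<close>, and
    \<open>agree_on_transfer\<close> would carry a good index in \<open>C\<close> from
    \<open>x\<close> to \<open>a\<close>.\<close>
  have realize: "\<exists>x\<in>univ ?L. \<forall>i\<in>C. \<not> D x i" if C: "C \<subseteq> Field r" "|C| \<le>o \<theta>" for C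
  proof -
    let ?W = "\<lambda>i. b i ` Field ls \<union> b' i ` Field ls"
    have im: "|f ` Field ls| \<le>o \<theta>" for f :: "'a \<Rightarrow> 'a"
      using card_of_image[of f "Field ls"] card_of_Field_ordIso[OF ls] \<theta>(2)
        ordLeq_ordIso_trans ordLeq_transitive by blast
    have W: "|?W i| \<le>o \<theta>" for i
      using card_of_Un_ordLeq_infinite_Field[OF inf(2) im im \<theta>(1)] .
    have "|\<Union>i\<in>C. ?W i| \<le>o \<theta>"
      by (rule card_of_UNION_ordLeq_infinite_Field[OF inf(2) \<theta>(1) C(2)]) (use W in simp)
    moreover have "(\<Union>i\<in>C. ?W i) \<subseteq> univ ?L" using b b' C(1) by blast
    ultimately obtain M0 where M0: "leK K M0 ?L" "(\<Union>i\<in>C. ?W i) \<subseteq> univ M0" "|univ M0| \<le>o \<theta>"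
      using LS_submodel[OF LS \<theta>(1,2) L] by blast
    have "gtp1 K a (univ M0) N \<in> gS K M0"
      using leK_trans[OF M0(1) N(1)] N(2) unfolding gS_def by blast
    moreover have "|univ M0| <o \<chi>" using M0(3) \<chi>(1) ordLeq_ordLess_trans by blast
    ultimately obtain x where x: "x \<in> univ ?L" "gtp1 K a (univ M0) N = gtp1 K x (univ M0) ?L"
      using satL M0(1) unfolding saturated_in_def by blast
    have M0N: "univ M0 \<subseteq> univ N" using leK_univ[OF leK_trans[OF M0(1) N(1)]] .
    have "same_type UNIV (univ M0) (\<lambda>_ :: unit. a, N) (\<lambda>_. x, ?L)"
      using x(2) gtp_eq_iff[OF NK M0N, of "\<lambda>_ :: unit. a" UNIV "\<lambda>_. x" ?L] N(2)
      unfolding gtp1_def by (simp add: image_subset_iff)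
    moreover have "same_type UNIV (univ M0) (\<lambda>_ :: unit. x, ?L) (\<lambda>_. x, N)"
      by (rule same_type_leK[OF N(1) leK_univ[OF M0(1)]]) (use x(1) in auto)
    ultimately have xa: "same_type UNIV (univ M0) (\<lambda>_ :: unit. x, N) (\<lambda>_. a, N)"
      using same_type_sym same_type_trans by blast
    have "\<not> D x i" if "i \<in> C" for i
    proof
      assume "D x i"
      then have "agree_on ls N a (b i) (b' i)"
        unfolding D_def by (rule agree_on_transfer[OF xa, rotated 2]) (use that M0(2) in blast)+
      then show False using a that C(1) by blast
    qed
    then show ?thesis using x(1) by blast
  qed
  have wo: "Well_order r"
    using chain unfolding universal_chain_def limit_order_def by blast
  have total: "(i, j) \<in> r \<or> (j, i) \<in> r" if "i \<in> Field r" "j \<in> Field r" for i j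
    using wo_rel.TOTALS[unfolded wo_rel_def, OF wo] that by blast
  have mono: "univ (M i) \<subseteq> univ (M j)" if "(i, j) \<in> r" for i j
    using chain that leK_univ unfolding universal_chain_def increasing_chain_def by blast
  \<comment> \<open>The element given by \<open>realize\<close> lies in some \<open>M j\<close>, and
    every index from \<open>j\<close> on is good for it, so \<open>C\<close> cannot pass
    \<open>j\<close>. Thus saturation forces the cofinality of \<open>r\<close> above
    \<open>\<theta>\<close>.\<close>
  have bounded: "\<exists>j\<in>Field r. \<forall>i\<in>C. (i, j) \<in> r" if C: "C \<subseteq> Field r" "|C| \<le>o \<theta>" for C
  proof -
    obtain x where x: "x \<in> univ ?L" "\<forall>i\<in>C. \<not> D x i" using realize[OF C] by blast
    then obtain j where j: "j \<in> Field r" "x \<in> univ (M j)" using limit(3) by blast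
    have "(i, j) \<in> r" if "i \<in> C" for i
    proof (rule ccontr)
      assume "(i, j) \<notin> r"
      then have "(j, i) \<in> r" using total[of i j] that C(1) j(1) by blast
      then have "D x i" using D[of i x] mono j(2) that C(1) by blast
      then show False using x(2) that by blast
    qed
    then show ?thesis using j(1) by blast
  qed
  \<comment> \<open>\<open>z\<close> is the pair of element and index chosen at stage
    \<open>k\<close>, and \<open>f\<close> records the choices so far. \<open>P\<close> reads
    \<open>f\<close> only below \<open>k\<close>, as well-founded dependent choice requires.\<close>
  define P where "P f k z \<longleftrightarrow> fst z \<in> univ ?L \<and> snd z \<in> Field r \<and>
      (\<forall>l\<in>underS \<theta> k. \<not> D (fst z) (snd (f l)) \<and> fst (f l) \<in> univ (M (snd z)))"
    for f :: "'a \<Rightarrow> 'a \<times> 'a" and k z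
  have "\<exists>f. \<forall>k. P f k (f k)"
  proof (rule dependent_wf_choice)
    show "wf (\<theta> - Id)" using \<theta>(1) by (auto simp: card_order_on_def well_order_on_def)
    show "P f k z = P g k z" if "\<And>l. (l, k) \<in> \<theta> - Id \<Longrightarrow> f l = g l" for f g k z
      using that unfolding P_def underS_def by auto
    fix k f assume "\<And>l. (l, k) \<in> \<theta> - Id \<Longrightarrow> P f l (f l)"
    then have f: "fst (f l) \<in> univ ?L" "snd (f l) \<in> Field r" if "l \<in> underS \<theta> k" for l
      using that unfolding P_def underS_def by auto
    have card: "|g ` underS \<theta> k| \<le>o \<theta>" for g :: "'a \<Rightarrow> 'a"
    proof -
      have "underS \<theta> k \<subseteq> Field \<theta>" by (auto simp: underS_def Field_def)
      then have "|underS \<theta> k| \<le>o \<theta>"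
        using card_of_mono1 card_of_Field_ordIso[OF \<theta>(1)] ordLeq_ordIso_trans by blast
      then show ?thesis using card_of_image ordLeq_transitive by blast
    qed
    obtain x where x: "x \<in> univ ?L" "\<forall>l\<in>underS \<theta> k. \<not> D x (snd (f l))"
      using realize[of "(\<lambda>l. snd (f l)) ` underS \<theta> k"] card f(2) by blast
    \<comment> \<open>Each earlier element enters the chain at some \<open>h l\<close>; a common
      bound \<open>j\<close> of these indices puts all of them into \<open>M j\<close> and serves as
      the next index.\<close>
    have "\<forall>l\<in>underS \<theta> k. \<exists>i. i \<in> Field r \<and> fst (f l) \<in> univ (M i)"
      using f(1) limit(3) by blast
    then obtain h where h: "\<And>l. l \<in> underS \<theta> k \<Longrightarrow> h l \<in> Field r \<and> fst (f l) \<in> univ (M (h l))"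
      by metis
    obtain j where j: "j \<in> Field r" "\<forall>l\<in>underS \<theta> k. (h l, j) \<in> r"
      using bounded[of "h ` underS \<theta> k"] card h by blast
    have "P f k (x, j)"
      unfolding P_def using x j h mono by fastforce
    then show "\<exists>z. P f k z" ..
  qed
  then obtain f where f: "\<And>k. P f k (f k)" by blast
  have "order_property K ls \<theta>"
  proof (rule order_propertyI[OF inf(1) NK])
    show "fst (f k) \<in> univ N" "b (snd (f k)) ` Field ls \<subseteq> univ N" "b' (snd (f k)) ` Field ls \<subseteq> univ N"
      for k
      using f[of k] b[of "snd (f k)"] b'[of "snd (f k)"] leK_univ[OF N(1)] unfolding P_def by blast+
    fix i j assume "(i, j) \<in> \<theta> - Id"
    then have "i \<in> underS \<theta> j" by (auto simp: underS_def)
    then have "\<not> D (fst (f j)) (snd (f i))" "fst (f i) \<in> univ (M (snd (f j)))" "snd (f j) \<in> Field r"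
      using f[of j] unfolding P_def by blast+
    \<comment> \<open>The earlier element lies in the model at the later index, which is therefore
      good for it.\<close>
    then show "agree_on ls N (fst (f i)) (b (snd (f j))) (b' (snd (f j)))"
      and "\<not> agree_on ls N (fst (f j)) (b (snd (f i))) (b' (snd (f i)))"
      using D unfolding D_def by blast+
  qed
  with \<theta>(3) show False by contradiction
qed

end

text \<open>By Cantor's theorem the first step of the beth sequence already exceeds
  \<open>c\<close>, and \<open>d\<close> bounds the sequence.\<close>

lemma is_beth_omega_ordLess:
  assumes "is_beth_omega c d"
  shows "c <o d"
proof -
  obtain b :: "nat \<Rightarrow> 'a rel" where b: "Card_order (b 0)" "b 0 =o c" "b (Suc 0) =o ctwo ^c b 0" "b (Suc 0) \<le>o d"
    using assms unfolding is_beth_omega_def by blast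
  have "b 0 <o b (Suc 0)"
    using ordLess_ctwo_cexp[OF b(1)] b(3) ordIso_symmetric ordLess_ordIso_trans by blast
  then show ?thesis
    using b(2,4) ordIso_symmetric ordIso_ordLess_trans ordLess_ordLeq_trans by blast
qed

theorem theorem3p18:
  fixes K :: "('f, 'r, 'a) abstract_class"
    and ls \<chi>0 \<chi>2 lam :: "'a rel"
  assumes universe: "strong_limit |UNIV :: 'a set|"
    and aec: "AEC K"
    and ls: "is_LS K ls"
    and monster: "has_monster_model K"
    and tame: "tame K ls"
    and stable: "\<exists>\<mu> :: 'a rel. Card_order \<mu> \<and> \<mu> <o |UNIV :: 'a set| \<and> ls \<le>o \<mu> \<and> stable_in K \<mu>"
    and chi0: "Card_order \<chi>0" "ls \<le>o \<chi>0" "\<not> order_property K ls \<chi>0"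
    and chi2: "is_beth_omega \<chi>0 \<chi>2"
    and lam: "Card_order lam" "lam <o |UNIV :: 'a set|" "\<chi>2 \<le>o lam" "stable_in K lam"
    and saturated: "\<exists>M\<in>models_of_card K lam. saturated K M"
    and limit_saturated: "\<And>L. limit_model K lam L \<Longrightarrow> saturated_in K \<chi>2 L"
  shows "no_long_splitting_chains K lam"
proof -
  have "infinite (UNIV :: 'a set)"
    using universe infinite_iff_natLeq_ordLeq unfolding strong_limit_def by blast
  then interpret aec K using aec by unfold_locales
  \<comment> \<open>\<open>\<chi>0\<close> serves as \<open>\<theta>\<close> and
    \<open>\<chi>2\<close> as \<open>\<chi>\<close>, so submodels of size at most
    \<open>\<chi>0\<close> fall under \<open>\<chi>2\<close>-saturation.\<close>
  show ?thesis
    using no_long_splitting_chains_if_limit_models_saturated[OF _ _ tame chi0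
        is_beth_omega_ordLess[OF chi2] lam(3,1,2) limit_saturated] monster ls
    unfolding has_monster_model_def is_LS_def by blast
qed

end
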